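(* Let $\mu,\nu$ be probability measures on $\mathbb{C}$ with $\operatorname{supp}\nu\subseteq B_K(0)$ for some $K>0$, let $U_\mu,U_\nu$ be their logarithmic potentials and fix some $1\le p\le\infty$. For any $a\ge 1/2$ we have $$D(\mu,\nu)\lesssim a^{1+1/p}\,\|U_\mu-U_\nu\|_{L^p(B_{K+1/a}(0))}+\sup_{R\ge 0,\,z_0\in\mathbb{C}}\nu\bigl(\overline{B_{R+1/a}(z_0)\setminus B_R(z_0)}\bigr).$$
   Context: Here $\lesssim$ denotes an inequality that holds up to a parameter-independent constant $c>0$. $B_R(z_0)$ is the ball (disc) in $\mathbb{C}$ of radius $R$ centred at $z_0$, and the bar denotes topological closure. The Kolmogorov distance over balls is $D(\mu,\nu)=\sup_{z_0\in\mathbb{C},\,R>0}|\mu(B_R(z_0))-\nu(B_R(z_0))|$. The logarithmic potential of a finite Radon measure $\mu$ on $\mathbb{C}$ is $U_\mu(z)=-\int_{\mathbb{C}}\log|t-z|\,d\mu(t)$; it satisfies $\Delta U_\mu=-2\pi\mu$ in the sense of distributions. $L^p$ norms are taken with respect to Lebesgue measure on $\mathbb{C}$, and $1/p=0$ for $p=\infty$.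
   Formalization: The implied constant may depend on K (but not on μ, ν, p or a); a constant independent of K as well is impossible for p > 1, as measures ν spread uniformly over large discs show. *)

theory Defs
  imports "HOL-Probability.Probability"
begin

definition measure_support :: "'a::topological_space measure \<Rightarrow> 'a set" where
  "measure_support M = {x. \<forall>U. open U \<and> x \<in> U \<longrightarrow> emeasure M U > 0}"

text \<open>
  Integral of an extended-real function as the difference of the integrals of its positive and
  negative parts (the function \<^const>\<open>e2ennreal\<close> sends negative values to \<open>0\<close>). Unlike the
  Bochner integral, which is \<open>0\<close> for every non-integrable function, it takes infinite values.
\<close>
definition ext_integral :: "'a measure \<Rightarrow> ('a \<Rightarrow> ereal) \<Rightarrow> ereal" where
  "ext_integral M f =
     enn2ereal (\<integral>\<^sup>+ x. e2ennreal (f x) \<partial>M) - enn2ereal (\<integral>\<^sup>+ x. e2ennreal (- f x) \<partial>M)"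

text \<open>\<open>log r\<close> for \<open>r \<ge> 0\<close> with \<open>log 0 = - \<infinity>\<close>; recall that \<open>ln 0 = 0\<close>.\<close>
definition ext_log :: "real \<Rightarrow> ereal" where
  "ext_log r = (if r = 0 then - \<infinity> else ereal (ln r))"

text \<open>
  For a finite measure \<open>M\<close> the two parts in the integral are both infinite at most for \<open>z\<close> in a
  Lebesgue null set, because the logarithmic singularity is locally integrable in the plane.
  If the logarithm is not integrable with respect to \<open>M\<close> at infinity, the potential is \<open>- \<infinity>\<close>
  almost everywhere.
\<close>
definition log_potential :: "complex measure \<Rightarrow> complex \<Rightarrow> ereal" where
  "log_potential M z = - ext_integral M (\<lambda>t. ext_log (norm (t - z)))"

text \<open>Power with a positive exponent.\<close>
definition ennreal_powr :: "ennreal \<Rightarrow> real \<Rightarrow> ennreal" where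
  "ennreal_powr x r = (if x = \<infinity> then \<infinity> else ennreal (enn2real x powr r))"

text \<open>The \<open>L\<^sup>p\<close> norm with respect to Lebesgue measure on \<open>S\<close>, with values in \<open>[0, \<infinity>]\<close>.\<close>
definition Lp_norm_on :: "ennreal \<Rightarrow> 'a::euclidean_space set \<Rightarrow> ('a \<Rightarrow> ereal) \<Rightarrow> ennreal" where
  "Lp_norm_on p S f =
     (if p = \<infinity> then esssup (restrict_space lborel S) (\<lambda>x. e2ennreal \<bar>f x\<bar>)
      else ennreal_powr
             (\<integral>\<^sup>+ x \<in> S. ennreal_powr (e2ennreal \<bar>f x\<bar>) (enn2real p) \<partial>lborel)
             (1 / enn2real p))"

definition kolmogorov_ball_dist :: "complex measure \<Rightarrow> complex measure \<Rightarrow> real" where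
  "kolmogorov_ball_dist M N =
     (SUP (z, R) \<in> UNIV \<times> {0<..}. \<bar>measure M (ball z R) - measure N (ball z R)\<bar>)"

end

theory Submission
  imports Defs
begin

text \<open>
  Put \<open>h = 1 / a\<close>. The logarithm is a multiple of the fundamental solution of the Laplacian: every
  compactly supported \<open>C\<^sup>2\<close> function satisfies
  \<open>newton_const * f t = \<integral> \<Delta>f(z) ln \<bar>t - z\<bar> dz\<close> (lemma \<open>newtonian_potential\<close>). Integrating in \<open>t\<close>
  and exchanging the integrals gives
  \<open>newton_const * (\<integral> f d\<mu> - \<integral> f d\<nu>) = - \<integral> \<Delta>f (U\<^sub>\<mu> - U\<^sub>\<nu>)\<close>, so closeness of the potentials
  controls every smooth test function (lemma \<open>integral_difference_le\<close>).

  The test functions are indicators of discs smoothed at scale \<open>h\<close>. Their Laplacian is of size \<open>a\<^sup>2\<close>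
  and lives on annuli of thickness \<open>h\<close>. Inside a fixed disc such annuli have area of order \<open>h\<close>,
  whatever their radius and centre (lemma \<open>emeasure_annulus_Int_cball\<close>). Hoelder's inequality then
  yields the factor \<open>a\<^sup>2 * h powr (1 - 1 / p) = a powr (1 + 1 / p)\<close> (lemma \<open>test_discrepancy\<close>).

  The potentials are compared only on the disc of radius \<open>K + h\<close>, whereas the discs to be measured are
  arbitrary. Therefore each smoothed indicator is multiplied by a smoothed indicator of a disc about
  the origin. This loses the mass of \<open>\<mu>\<close> outside the disc of radius \<open>K\<close>. Testing with
  a function supported in that disc shows that the lost mass is small, because \<open>\<nu>\<close> has all its
  mass there. Replacing smoothed by sharp indicators costs the \<open>\<nu>\<close>-mass of an annulus of thickness \<open>h\<close>,
  the second term of the estimate (lemma \<open>ball_discrepancy_le\<close>).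

  The representation of \<open>f\<close> is proved without polar coordinates: the regularised logarithm
  \<open>ln (\<bar>z\<bar>\<^sup>2 + \<epsilon>\<^sup>2) / 2\<close> is smooth, its Laplacian is an approximate identity by scaling, and Green's
  identity reduces to one-dimensional integration by parts on lines. Potentials with infinite values are
  dealt with by the finiteness of the norm: it forces both potentials to be finite at some point,
  hence both measures to have a logarithmic moment, which is the integrability that the exchange of
  integrals needs.
\<close>

section \<open>Lebesgue measure on the complex plane\<close>

lemma measurable_Complex [measurable]:
  assumes [measurable]: "f \<in> borel_measurable M" "g \<in> borel_measurable M"
  shows "(\<lambda>x. Complex (f x) (g x)) \<in> borel_measurable M"
proof -
  have "(\<lambda>x. complex_of_real (f x) + \<i> * complex_of_real (g x)) \<in> borel_measurable M"
    by measurable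
  then show ?thesis by (simp add: complex_eq[symmetric] Complex_eq)
qed

lemma lborel_complex:
  "(lborel :: complex measure) = distr (lborel \<Otimes>\<^sub>M lborel) borel (\<lambda>(x, y). Complex x y)"
proof (rule lborel_eqI)
  fix l u :: complex
  assume le: "\<And>b. b \<in> Basis \<Longrightarrow> l \<bullet> b \<le> u \<bullet> b"
  have "Re l \<le> Re u" "Im l \<le> Im u"
    using le[of 1] le[of \<i>] by (auto simp: Basis_complex_def)
  moreover have "(\<lambda>(x, y). Complex x y) -` box l u \<inter> space (lborel \<Otimes>\<^sub>M lborel)
      = box (Re l) (Re u) \<times> box (Im l) (Im u)"
    by (auto simp: box_def Basis_complex_def space_pair_measure)
  ultimately show "emeasure (distr (lborel \<Otimes>\<^sub>M lborel) borel (\<lambda>(x, y). Complex x y)) (box l u)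
      = ennreal (\<Prod>b\<in>Basis. (u - l) \<bullet> b)"
    by (simp add: emeasure_distr lborel.emeasure_pair_measure_Times Basis_complex_def ennreal_mult)
qed simp

lemma nn_integral_complex:
  fixes f :: "complex \<Rightarrow> ennreal"
  assumes [measurable]: "f \<in> borel_measurable borel"
  shows "(\<integral>\<^sup>+z. f z \<partial>lborel) = (\<integral>\<^sup>+x. \<integral>\<^sup>+y. f (Complex x y) \<partial>lborel \<partial>lborel)"
    and "(\<integral>\<^sup>+z. f z \<partial>lborel) = (\<integral>\<^sup>+y. \<integral>\<^sup>+x. f (Complex x y) \<partial>lborel \<partial>lborel)"
proof -
  have *: "(\<integral>\<^sup>+z. f z \<partial>lborel) = (\<integral>\<^sup>+p. f (case p of (x, y) \<Rightarrow> Complex x y) \<partial>(lborel \<Otimes>\<^sub>M lborel))"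
    by (subst lborel_complex, subst nn_integral_distr) simp_all
  show "(\<integral>\<^sup>+z. f z \<partial>lborel) = (\<integral>\<^sup>+x. \<integral>\<^sup>+y. f (Complex x y) \<partial>lborel \<partial>lborel)"
    unfolding * by (subst lborel.nn_integral_fst [symmetric]) simp_all
  show "(\<integral>\<^sup>+z. f z \<partial>lborel) = (\<integral>\<^sup>+y. \<integral>\<^sup>+x. f (Complex x y) \<partial>lborel \<partial>lborel)"
    unfolding * by (subst lborel_pair.nn_integral_snd [symmetric]) simp_all
qed

lemma integral_complex:
  fixes f :: "complex \<Rightarrow> real"
  assumes f: "integrable lborel f"
  shows "(\<integral>z. f z \<partial>lborel) = (\<integral>x. \<integral>y. f (Complex x y) \<partial>lborel \<partial>lborel)"
    and "(\<integral>z. f z \<partial>lborel) = (\<integral>y. \<integral>x. f (Complex x y) \<partial>lborel \<partial>lborel)"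
proof -
  have [measurable]: "f \<in> borel_measurable borel" using f by auto
  have *: "(\<integral>z. f z \<partial>lborel) = (\<integral>p. f (case p of (x, y) \<Rightarrow> Complex x y) \<partial>(lborel \<Otimes>\<^sub>M lborel))"
    by (subst lborel_complex, subst integral_distr) simp_all
  have int: "integrable (lborel \<Otimes>\<^sub>M lborel) (\<lambda>p. f (case p of (x, y) \<Rightarrow> Complex x y))"
    using f by (subst (asm) lborel_complex, subst (asm) integrable_distr_eq) simp_all
  show "(\<integral>z. f z \<partial>lborel) = (\<integral>x. \<integral>y. f (Complex x y) \<partial>lborel \<partial>lborel)"
    unfolding * using lborel_pair.integral_fst'[OF int] by simp
  have "integrable (lborel \<Otimes>\<^sub>M lborel) (case_prod (\<lambda>x y. f (Complex x y)))"
    using int by (simp add: case_prod_unfold)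
  from lborel_pair.integral_snd[OF this]
  show "(\<integral>z. f z \<partial>lborel) = (\<integral>y. \<integral>x. f (Complex x y) \<partial>lborel \<partial>lborel)"
    unfolding * by (simp add: case_prod_unfold)
qed

lemma nn_integral_complex_affine:
  fixes f :: "complex \<Rightarrow> ennreal"
  assumes [measurable]: "f \<in> borel_measurable borel" and "c > 0"
  shows "(\<integral>\<^sup>+z. f z \<partial>lborel) = ennreal (c\<^sup>2) * (\<integral>\<^sup>+z. f (t + c *\<^sub>R z) \<partial>lborel)"
  using assms(2)
  by (subst lborel_affine[of c t])
     (simp_all add: nn_integral_density nn_integral_distr nn_integral_cmult ennreal_power)

lemma integral_complex_affine:
  fixes f :: "complex \<Rightarrow> real"
  assumes [measurable]: "f \<in> borel_measurable borel" and "c > 0"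
  shows "(\<integral>z. f z \<partial>lborel) = c\<^sup>2 * (\<integral>z. f (t + c *\<^sub>R z) \<partial>lborel)"
proof -
  have "(\<integral>z. f z \<partial>lborel)
      = (\<integral>z. f z \<partial>density (distr lborel borel (\<lambda>x. t + c *\<^sub>R x)) (\<lambda>_. ennreal (c\<^sup>2)))"
    using assms(2) by (subst lborel_affine[of c t]) (simp_all add: ennreal_power)
  also have "\<dots> = c\<^sup>2 * (\<integral>z. f (t + c *\<^sub>R z) \<partial>lborel)"
    by (subst integral_density) (simp_all add: integral_distr)
  finally show ?thesis .
qed

section \<open>Area of a thin annulus inside a disc\<close>

text \<open>
  In a one-dimensional slice at height \<open>s\<close>, kept only where \<open>\<bar>x - x0\<bar> \<ge> \<bar>s\<bar>\<close>, the distance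
  \<open>sqrt ((x - x0)\<^sup>2 + s\<^sup>2)\<close> grows at rate at least \<open>1 / sqrt 2\<close> in \<open>\<bar>x - x0\<bar>\<close>. An increase of the
  distance by \<open>h\<close> thus confines \<open>\<bar>x - x0\<bar>\<close> to an interval of length at most \<open>2 * h\<close>, on each
  side of \<open>x0\<close>.
\<close>
lemma annulus_slice:
  fixes x0 s r h :: real
  assumes "r \<ge> 0" "h > 0"
  shows "emeasure lborel {x. \<bar>x - x0\<bar> \<ge> \<bar>s\<bar> \<and> r\<^sup>2 \<le> (x - x0)\<^sup>2 + s\<^sup>2 \<and> (x - x0)\<^sup>2 + s\<^sup>2 \<le> (r + h)\<^sup>2}
    \<le> ennreal (4 * h)"
proof -
  \<comment> \<open>the least value that \<open>\<bar>x - x0\<bar>\<close> can take on the slice\<close>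
  define m where "m = max \<bar>s\<bar> (sqrt (max 0 (r\<^sup>2 - s\<^sup>2)))"
  have m: "m \<ge> 0" "m \<ge> \<bar>s\<bar>" "r\<^sup>2 \<le> m\<^sup>2 + s\<^sup>2"
  proof -
    show "m \<ge> 0" "m \<ge> \<bar>s\<bar>" by (auto simp: m_def)
    have "sqrt (max 0 (r\<^sup>2 - s\<^sup>2)) \<le> m" by (simp add: m_def)
    then have "max 0 (r\<^sup>2 - s\<^sup>2) \<le> m\<^sup>2" using \<open>m \<ge> 0\<close>
      using real_sqrt_le_iff real_le_lsqrt real_sqrt_le_mono sqrt_le_D by blast
    then show "r\<^sup>2 \<le> m\<^sup>2 + s\<^sup>2" by auto
  qed
  have "\<bar>x - x0\<bar> \<ge> m \<and> \<bar>x - x0\<bar> \<le> m + 2 * h"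
    if x: "\<bar>x - x0\<bar> \<ge> \<bar>s\<bar>" "r\<^sup>2 \<le> (x - x0)\<^sup>2 + s\<^sup>2" "(x - x0)\<^sup>2 + s\<^sup>2 \<le> (r + h)\<^sup>2" for x
  proof
    show "\<bar>x - x0\<bar> \<ge> m"
      using x(1,2) unfolding m_def by (auto intro!: real_le_lsqrt)
    show "\<bar>x - x0\<bar> \<le> m + 2 * h"
    proof (rule ccontr)
      assume "\<not> \<bar>x - x0\<bar> \<le> m + 2 * h"
      then have xm: "(x - x0)\<^sup>2 > (m + 2 * h)\<^sup>2"
        using m(1) \<open>h > 0\<close> by (metis add_nonneg_nonneg less_eq_real_def linorder_not_le mult_nonneg_nonneg power2_abs power_strict_mono zero_le_numeral zero_less_numeral pos2)
      have "r \<le> 2 * m"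
      proof -
        have "r\<^sup>2 \<le> (2 * m)\<^sup>2"
        proof -
          have sm: "s\<^sup>2 \<le> m\<^sup>2" using m(1,2) by (simp add: abs_le_square_iff[symmetric])
          from m(3) sm zero_le_power2[of m] have "r\<^sup>2 \<le> 4 * m\<^sup>2" by linarith
          then show ?thesis by (simp add: power_mult_distrib)
        qed
        then show ?thesis by (rule power2_le_imp_le) (use m(1) in simp)
      qed
      then have hr: "h * r \<le> h * (2 * m)" using \<open>h > 0\<close> by simp
      have "(x - x0)\<^sup>2 + s\<^sup>2 > (r + h)\<^sup>2"
      proof -
        have "(m + 2 * h)\<^sup>2 = m\<^sup>2 + 2 * (h * (2 * m)) + 4 * h\<^sup>2" "(r + h)\<^sup>2 = r\<^sup>2 + 2 * (h * r) + h\<^sup>2"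
          by (simp_all add: power2_eq_square algebra_simps)
        with hr xm m(3) zero_le_power2[of h] show ?thesis by linarith
      qed
      then show False using x(3) by simp
    qed
  qed
  then have "{x. \<bar>x - x0\<bar> \<ge> \<bar>s\<bar> \<and> r\<^sup>2 \<le> (x - x0)\<^sup>2 + s\<^sup>2 \<and> (x - x0)\<^sup>2 + s\<^sup>2 \<le> (r + h)\<^sup>2}
      \<subseteq> {x0 + m..x0 + m + 2 * h} \<union> {x0 - m - 2 * h..x0 - m}"
    by (fastforce simp: abs_le_iff abs_if split: if_splits)
  then have "emeasure lborel {x. \<bar>x - x0\<bar> \<ge> \<bar>s\<bar> \<and> r\<^sup>2 \<le> (x - x0)\<^sup>2 + s\<^sup>2 \<and> (x - x0)\<^sup>2 + s\<^sup>2 \<le> (r + h)\<^sup>2}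
      \<le> emeasure lborel ({x0 + m..x0 + m + 2 * h} \<union> {x0 - m - 2 * h..x0 - m})"
    by (rule emeasure_mono) simp
  also have "\<dots> \<le> emeasure lborel {x0 + m..x0 + m + 2 * h} + emeasure lborel {x0 - m - 2 * h..x0 - m}"
    by (rule emeasure_subadditive) auto
  also have "\<dots> = ennreal (4 * h)"
    using \<open>h > 0\<close> by (simp flip: ennreal_plus)
  finally show ?thesis .
qed

text \<open>
  The bound is uniform in the radius \<open>r\<close> and the centre \<open>z0\<close>, although the whole annulus has area
  of order \<open>r * h\<close>. Where \<open>z - z0\<close> is closer to the horizontal, \<open>H\<close> is cut into horizontal slices
  of length at most \<open>4 * h\<close>, and the disc has only \<open>2 * L\<close> worth of heights; the remaining part
  \<open>V\<close> is treated with the coordinates exchanged.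
\<close>
lemma emeasure_annulus_Int_cball:
  fixes z0 :: complex
  assumes "r \<ge> 0" "h > 0" "L > 0"
  shows "emeasure lborel {z \<in> cball 0 L. r \<le> norm (z - z0) \<and> norm (z - z0) \<le> r + h}
    \<le> ennreal (16 * L * h)"
proof -
  define slice where "slice x0 s = {x::real. \<bar>x - x0\<bar> \<ge> \<bar>s\<bar> \<and> r\<^sup>2 \<le> (x - x0)\<^sup>2 + s\<^sup>2 \<and> (x - x0)\<^sup>2 + s\<^sup>2 \<le> (r + h)\<^sup>2}" for x0 s
  define H where "H = {z::complex. \<bar>Im z\<bar> \<le> L \<and> Re z \<in> slice (Re z0) (Im z - Im z0)}"
  define V where "V = {z::complex. \<bar>Re z\<bar> \<le> L \<and> Im z \<in> slice (Im z0) (Re z - Re z0)}"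
  have [measurable]: "H \<in> sets borel" "V \<in> sets borel"
    unfolding H_def V_def slice_def by simp_all
  have "{z \<in> cball 0 L. r \<le> norm (z - z0) \<and> norm (z - z0) \<le> r + h} \<subseteq> H \<union> V"
  proof
    fix z assume z: "z \<in> {z \<in> cball 0 L. r \<le> norm (z - z0) \<and> norm (z - z0) \<le> r + h}"
    then have "\<bar>Re z\<bar> \<le> L" "\<bar>Im z\<bar> \<le> L"
      using abs_Re_le_cmod[of z] abs_Im_le_cmod[of z] by auto
    moreover have "r\<^sup>2 \<le> (norm (z - z0))\<^sup>2" "(norm (z - z0))\<^sup>2 \<le> (r + h)\<^sup>2"
      using z \<open>r \<ge> 0\<close> by (auto intro!: power_mono)
    ultimately show "z \<in> H \<union> V"
      unfolding cmod_power2 H_def V_def slice_def by (auto simp: add.commute)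
  qed
  then have "emeasure lborel {z \<in> cball 0 L. r \<le> norm (z - z0) \<and> norm (z - z0) \<le> r + h}
      \<le> emeasure lborel (H \<union> V)"
    by (rule emeasure_mono) simp
  also have "\<dots> \<le> emeasure lborel H + emeasure lborel V"
    by (rule emeasure_subadditive) auto
  also have "emeasure lborel H \<le> ennreal (8 * L * h)"
  proof -
    have "emeasure lborel H = (\<integral>\<^sup>+z. indicator H z \<partial>lborel)" by simp
    also have "\<dots> = (\<integral>\<^sup>+y. \<integral>\<^sup>+x. indicator H (Complex x y) \<partial>lborel \<partial>lborel)"
      by (rule nn_integral_complex) simp
    also have "\<dots> \<le> (\<integral>\<^sup>+y. ennreal (4 * h) * indicator {-L..L} y \<partial>lborel)"
    proof (rule nn_integral_mono)
      fix y :: real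
      have [measurable]: "slice (Re z0) (y - Im z0) \<in> sets borel" by (simp add: slice_def)
      have "(\<integral>\<^sup>+x. indicator H (Complex x y) \<partial>lborel)
          = (\<integral>\<^sup>+x. indicator (slice (Re z0) (y - Im z0)) x * indicator {-L..L} y \<partial>lborel)"
        by (intro nn_integral_cong) (auto simp: H_def indicator_def abs_le_iff)
      also have "\<dots> = emeasure lborel (slice (Re z0) (y - Im z0)) * indicator {-L..L} y"
        by (subst nn_integral_multc) auto
      also have "\<dots> \<le> ennreal (4 * h) * indicator {-L..L} y"
        unfolding slice_def by (intro mult_right_mono annulus_slice assms) auto
      finally show "(\<integral>\<^sup>+x. indicator H (Complex x y) \<partial>lborel) \<le> ennreal (4 * h) * indicator {-L..L} y" .
    qed
    also have "\<dots> = ennreal (8 * L * h)"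
      using assms by (simp add: nn_integral_cmult flip: ennreal_mult)
    finally show ?thesis .
  qed
  also have "emeasure lborel V \<le> ennreal (8 * L * h)"
  proof -
    have "emeasure lborel V = (\<integral>\<^sup>+z. indicator V z \<partial>lborel)" by simp
    also have "\<dots> = (\<integral>\<^sup>+x. \<integral>\<^sup>+y. indicator V (Complex x y) \<partial>lborel \<partial>lborel)"
      by (rule nn_integral_complex) simp
    also have "\<dots> \<le> (\<integral>\<^sup>+x. ennreal (4 * h) * indicator {-L..L} x \<partial>lborel)"
    proof (rule nn_integral_mono)
      fix x :: real
      have [measurable]: "slice (Im z0) (x - Re z0) \<in> sets borel" by (simp add: slice_def)
      have "(\<integral>\<^sup>+y. indicator V (Complex x y) \<partial>lborel)
          = (\<integral>\<^sup>+y. indicator (slice (Im z0) (x - Re z0)) y * indicator {-L..L} x \<partial>lborel)"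
        by (intro nn_integral_cong) (auto simp: V_def indicator_def abs_le_iff)
      also have "\<dots> = emeasure lborel (slice (Im z0) (x - Re z0)) * indicator {-L..L} x"
        by (subst nn_integral_multc) auto
      also have "\<dots> \<le> ennreal (4 * h) * indicator {-L..L} x"
        unfolding slice_def by (intro mult_right_mono annulus_slice assms) auto
      finally show "(\<integral>\<^sup>+y. indicator V (Complex x y) \<partial>lborel) \<le> ennreal (4 * h) * indicator {-L..L} x" .
    qed
    also have "\<dots> = ennreal (8 * L * h)"
      using assms by (simp add: nn_integral_cmult flip: ennreal_mult)
    finally show ?thesis .
  qed
  also have "ennreal (8 * L * h) + ennreal (8 * L * h) = ennreal (16 * L * h)"
    using assms by (simp flip: ennreal_plus)
  finally show ?thesis by (simp add: add_mono)
qed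

section \<open>Local integrability of the logarithm\<close>

text \<open>
  Comparison with the integrable power \<open>x powr (-1/2)\<close>, since
  \<open>- ln x = 2 * ln (x powr (-1/2)) \<le> 2 * x powr (-1/2)\<close>.
\<close>
lemma nn_integral_neg_ln_real:
  "(\<integral>\<^sup>+x. ennreal (max 0 (- ln \<bar>x\<bar>)) * indicator {-1..1} x \<partial>lborel) < \<infinity>"
proof -
  have I: "((\<lambda>x::real. x powr (-1/2)) has_integral 2) {0..1}"
    using has_integral_powr_from_0[of "-1/2" 1] by simp
  have p: "(\<integral>\<^sup>+x. ennreal (indicator {0..1} x * x powr (-1/2)) \<partial>lborel) = ennreal 2"
    by (rule nn_integral_has_integral_lebesgue[OF _ I]) simp
  have half: "(\<integral>\<^sup>+x. ennreal (max 0 (- ln \<bar>x\<bar>)) * indicator {0..1} x \<partial>lborel) \<le> ennreal 4"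
  proof -
    have "(\<integral>\<^sup>+x. ennreal (max 0 (- ln \<bar>x\<bar>)) * indicator {0..1} x \<partial>lborel)
        \<le> (\<integral>\<^sup>+x. ennreal 2 * ennreal (indicator {0..1} x * x powr (-1/2)) \<partial>lborel)"
    proof (rule nn_integral_mono)
      fix x :: real
      have "max 0 (- ln x) \<le> 2 * x powr (-1/2)" if "0 < x"
      proof -
        have "ln (x powr (-1/2)) \<le> x powr (-1/2) - 1"
          using that by (intro ln_le_minus_one) simp
        moreover have "0 \<le> x powr (-1/2)" by simp
        ultimately show ?thesis using that by (simp add: ln_powr)
      qed
      then show "ennreal (max 0 (- ln \<bar>x\<bar>)) * indicator {0..1} x
          \<le> ennreal 2 * ennreal (indicator {0..1} x * x powr (-1/2))"
        by (cases "x = 0") (auto simp: indicator_def ennreal_mult[symmetric] simp del: ennreal_numeral intro!: ennreal_leI)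
    qed
    also have "\<dots> = ennreal 2 * ennreal 2"
      unfolding p[symmetric] by (rule nn_integral_cmult) simp
    also have "\<dots> = ennreal 4" by (simp flip: ennreal_mult)
    finally show ?thesis .
  qed
  have refl: "(\<integral>\<^sup>+x. ennreal (max 0 (- ln \<bar>x\<bar>)) * indicator {-1..0} x \<partial>lborel)
      = (\<integral>\<^sup>+x. ennreal (max 0 (- ln \<bar>x\<bar>)) * indicator {0..1} x \<partial>lborel)"
    by (subst nn_integral_real_affine[where c = "-1" and t = 0])
       (auto intro!: nn_integral_cong simp: indicator_def)
  have "(\<integral>\<^sup>+x. ennreal (max 0 (- ln \<bar>x\<bar>)) * indicator {-1..1} x \<partial>lborel)
      \<le> (\<integral>\<^sup>+x. ennreal (max 0 (- ln \<bar>x\<bar>)) * indicator {-1..0} x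
            + ennreal (max 0 (- ln \<bar>x\<bar>)) * indicator {0..1} x \<partial>lborel)"
    by (intro nn_integral_mono) (auto simp: indicator_def)
  also have "\<dots> = (\<integral>\<^sup>+x. ennreal (max 0 (- ln \<bar>x\<bar>)) * indicator {-1..0} x \<partial>lborel)
        + (\<integral>\<^sup>+x. ennreal (max 0 (- ln \<bar>x\<bar>)) * indicator {0..1} x \<partial>lborel)"
    by (rule nn_integral_add) auto
  also have "\<dots> \<le> ennreal 4 + ennreal 4"
    unfolding refl by (intro add_mono half)
  also have "\<dots> < \<infinity>" by simp
  finally show ?thesis .
qed

definition log_mass :: ennreal where
  "log_mass = (\<integral>\<^sup>+z. ennreal (max 0 (- ln (norm (z :: complex)))) \<partial>lborel)"

text \<open>
  The negative part of the logarithm lives on the unit disc, where \<open>\<bar>Re z\<bar> \<le> norm z\<close> reduces the claim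
  to the line.
\<close>
lemma log_mass_finite: "log_mass < \<infinity>"
proof -
  let ?l = "\<lambda>x. ennreal (max 0 (- ln \<bar>x\<bar>)) * indicator {-1..1::real} x"
  have "log_mass = (\<integral>\<^sup>+y. \<integral>\<^sup>+x. ennreal (max 0 (- ln (norm (Complex x y)))) \<partial>lborel \<partial>lborel)"
    unfolding log_mass_def by (rule nn_integral_complex) simp
  also have "\<dots> \<le> (\<integral>\<^sup>+y. \<integral>\<^sup>+x. ?l x * indicator {-1..1::real} y \<partial>lborel \<partial>lborel)"
  proof (rule nn_integral_mono)
    fix y :: real
    have *: "AE x in lborel. x \<noteq> (0::real)"
      by (rule AE_lborel_singleton)
    show "(\<integral>\<^sup>+x. ennreal (max 0 (- ln (norm (Complex x y)))) \<partial>lborel)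
       \<le> (\<integral>\<^sup>+x. ?l x * indicator {-1..1} y \<partial>lborel)"
    proof (rule nn_integral_mono_AE, use * in eventually_elim)
      case (elim x)
      have xy: "\<bar>x\<bar> \<le> norm (Complex x y)" "\<bar>y\<bar> \<le> norm (Complex x y)"
        using abs_Re_le_cmod[of "Complex x y"] abs_Im_le_cmod[of "Complex x y"] by auto
      show ?case
      proof (cases "norm (Complex x y) \<le> 1")
        case True
        then have "x \<in> {-1..1}" "y \<in> {-1..1}" using xy by auto
        moreover have "ln \<bar>x\<bar> \<le> ln (norm (Complex x y))"
          using xy elim by (subst ln_le_cancel_iff) auto
        ultimately show ?thesis by (auto intro!: ennreal_leI simp del: complex_norm)
      next
        case False
        then have "ln (norm (Complex x y)) \<ge> 0" by simp
        then show ?thesis by (simp del: complex_norm)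
      qed
    qed
  qed
  also have "\<dots> = (\<integral>\<^sup>+y. (\<integral>\<^sup>+x. ?l x \<partial>lborel) * indicator {-1..1::real} y \<partial>lborel)"
    by (intro nn_integral_cong, subst nn_integral_multc) auto
  also have "\<dots> = (\<integral>\<^sup>+x. ?l x \<partial>lborel) * ennreal 2"
    by (subst nn_integral_cmult) auto
  also have "\<dots> < \<infinity>"
    using nn_integral_neg_ln_real by (simp add: ennreal_mult_less_top)
  finally show ?thesis .
qed

text \<open>
  The dependence on \<open>t\<close> is only logarithmic: by translation invariance the singularity at \<open>z = t\<close>
  always contributes at most \<open>log_mass\<close>. This growth is what a measure with a finite logarithmic moment
  can absorb when potentials are integrated over a disc.
\<close>
lemma nn_integral_abs_ln_cball:
  fixes t :: complex
  assumes "L > 0"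
  shows "(\<integral>\<^sup>+z. ennreal \<bar>ln (norm (t - z))\<bar> * indicator (cball 0 L) z \<partial>lborel)
    \<le> log_mass + ennreal (ln (1 + L) + ln (1 + norm t)) * emeasure lborel (cball 0 L :: complex set)"
proof -
  have "(\<integral>\<^sup>+z. ennreal \<bar>ln (norm (t - z))\<bar> * indicator (cball 0 L) z \<partial>lborel)
     \<le> (\<integral>\<^sup>+z. ennreal (max 0 (- ln (norm (t - z))))
          + ennreal (ln (1 + L) + ln (1 + norm t)) * indicator (cball 0 L) z \<partial>lborel)"
  proof (rule nn_integral_mono)
    fix z :: complex
    show "ennreal \<bar>ln (norm (t - z))\<bar> * indicator (cball 0 L) z \<le> ennreal (max 0 (- ln (norm (t - z))))
          + ennreal (ln (1 + L) + ln (1 + norm t)) * indicator (cball 0 L) z"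
    proof (cases "z \<in> cball 0 L")
      case True
      have "ln (norm (t - z)) \<le> ln (1 + L) + ln (1 + norm t)"
      proof (cases "t = z")
        case False
        have "norm (t - z) \<le> norm t + L"
          using True norm_triangle_ineq4[of t z] by simp
        also have "\<dots> \<le> (1 + L) * (1 + norm t)"
          using assms by (simp add: algebra_simps)
        finally have "ln (norm (t - z)) \<le> ln ((1 + L) * (1 + norm t))"
          using False assms by (subst ln_le_cancel_iff) (auto intro!: mult_pos_pos add_pos_nonneg)
        also have "\<dots> = ln (1 + L) + ln (1 + norm t)"
          using assms by (intro ln_mult_pos) (auto intro!: add_pos_nonneg)
        finally show ?thesis .
      qed (use assms in simp)
      moreover have "0 \<le> ln (1 + L) + ln (1 + norm t)" using assms by simp
      ultimately have "ennreal \<bar>ln (norm (t - z))\<bar>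
          \<le> ennreal (max 0 (- ln (norm (t - z))) + (ln (1 + L) + ln (1 + norm t)))"
        by (intro ennreal_leI) auto
      also have "\<dots> = ennreal (max 0 (- ln (norm (t - z)))) + ennreal (ln (1 + L) + ln (1 + norm t))"
        using \<open>0 \<le> ln (1 + L) + ln (1 + norm t)\<close> by (subst ennreal_plus) auto
      finally show ?thesis using True by simp
    qed simp
  qed
  also have "\<dots> = (\<integral>\<^sup>+z. ennreal (max 0 (- ln (norm (t - z)))) \<partial>lborel)
      + ennreal (ln (1 + L) + ln (1 + norm t)) * emeasure lborel (cball 0 L :: complex set)"
    by (subst nn_integral_add) (simp_all add: nn_integral_cmult_indicator borel_measurable_times_ennreal borel_measurable_indicator)
  also have "(\<integral>\<^sup>+z. ennreal (max 0 (- ln (norm (t - z)))) \<partial>lborel) = log_mass"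
    unfolding log_mass_def
    by (subst nn_integral_complex_affine[where c = 1 and t = t]) simp_all
  finally show ?thesis .
qed

lemma integrable_ln_cball:
  fixes t :: complex
  assumes "L > 0"
  shows "integrable lborel (\<lambda>z. \<bar>ln (norm (t - z))\<bar> * indicator (cball 0 L) z)"
proof (rule integrableI_nonneg)
  have "(\<integral>\<^sup>+z. ennreal (\<bar>ln (norm (t - z))\<bar> * indicator (cball 0 L) z) \<partial>lborel)
      = (\<integral>\<^sup>+z. ennreal \<bar>ln (norm (t - z))\<bar> * indicator (cball 0 L) z \<partial>lborel)"
    by (intro nn_integral_cong) (auto simp: indicator_def)
  also have "\<dots> \<le> log_mass
      + ennreal (ln (1 + L) + ln (1 + norm t)) * emeasure lborel (cball 0 L :: complex set)"
    by (rule nn_integral_abs_ln_cball[OF assms])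
  also have "\<dots> < \<infinity>"
    using log_mass_finite emeasure_lborel_cball_finite[of "0::complex" L]
    by (simp add: ennreal_mult_less_top)
  finally show "(\<integral>\<^sup>+z. ennreal (\<bar>ln (norm (t - z))\<bar> * indicator (cball 0 L) z) \<partial>lborel) < \<infinity>" .
qed (auto intro!: borel_measurable_times borel_measurable_indicator)

section \<open>The logarithm as fundamental solution of the Laplacian\<close>

lemma integrable_continuous_cball:
  fixes f :: "'a::euclidean_space \<Rightarrow> real"
  assumes "continuous_on UNIV f" "\<And>z. norm z \<ge> L \<Longrightarrow> f z = 0"
  shows "integrable lborel f"
proof -
  have "integrable lborel (\<lambda>x. indicator (cball 0 L) x *\<^sub>R f x)"
    by (rule borel_integrable_compact) (auto intro: continuous_on_subset[OF assms(1)])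
  also have "(\<lambda>x. indicator (cball 0 L) x *\<^sub>R f x) = f"
    using assms(2) by (auto simp: fun_eq_iff indicator_def)
  finally show ?thesis .
qed

text \<open>
  The integrand is the derivative of the Wronskian \<open>u' v - u v'\<close>, which has compact support.
\<close>
lemma integral_by_parts_twice:
  fixes u u' u'' v v' v'' :: "real \<Rightarrow> real"
  assumes u: "\<And>x. (u has_real_derivative u' x) (at x)" "\<And>x. (u' has_real_derivative u'' x) (at x)"
    and v: "\<And>x. (v has_real_derivative v' x) (at x)" "\<And>x. (v' has_real_derivative v'' x) (at x)"
    and cont: "continuous_on UNIV u''" "continuous_on UNIV v''"
    and zero: "\<And>x. \<bar>x\<bar> \<ge> L \<Longrightarrow> u x = 0 \<and> u' x = 0 \<and> u'' x = 0"
  shows "(\<integral>x. u'' x * v x - u x * v'' x \<partial>lborel) = 0"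
proof -
  define F where "F x = u' x * v x - u x * v' x" for x
  define f where "f x = u'' x * v x - u x * v'' x" for x
  have F: "(F has_real_derivative f x) (at x)" for x
    unfolding F_def f_def
    by (auto intro!: derivative_eq_intros u v simp: algebra_simps)
  have cuv: "isCont u x" "isCont v x" "isCont u'' x" "isCont v'' x" for x
    using u v cont by (auto intro: DERIV_isCont simp: continuous_on_eq_continuous_at)
  have "isCont f x" for x unfolding f_def by (intro continuous_intros cuv)
  then have "has_bochner_integral lborel (\<lambda>x. f x * indicator {-\<bar>L\<bar>..\<bar>L\<bar>} x) (F \<bar>L\<bar> - F (-\<bar>L\<bar>))"
    by (intro has_bochner_integral_FTC_Icc_real F) auto
  moreover have "(\<lambda>x. f x * indicator {-\<bar>L\<bar>..\<bar>L\<bar>} x) = f"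
  proof
    fix x show "f x * indicator {-\<bar>L\<bar>..\<bar>L\<bar>} x = f x"
      using zero[of x] by (cases "\<bar>x\<bar> \<ge> L") (auto simp: f_def indicator_def)
  qed
  moreover have "F \<bar>L\<bar> = 0" "F (-\<bar>L\<bar>) = 0"
    using zero[of "\<bar>L\<bar>"] zero[of "-\<bar>L\<bar>"] by (auto simp: F_def)
  ultimately show ?thesis
    unfolding f_def[symmetric] by (simp add: has_bochner_integral_integral_eq)
qed

text \<open>
  The Laplacian of the regularised logarithm \<open>ln (1 + (norm w)\<^sup>2) / 2\<close>.
\<close>
definition newton_kernel :: "complex \<Rightarrow> real" where
  "newton_kernel w = 2 / (1 + (norm w)\<^sup>2)\<^sup>2"

text \<open>
  Its value is \<open>2 * pi\<close>, the constant in \<open>\<Delta>U = - 2 * pi * \<mu>\<close>; all that matters below is that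
  it is finite and positive.
\<close>
definition newton_const :: real where
  "newton_const = (\<integral>w. newton_kernel w \<partial>lborel)"

lemma newton_kernel_pos: "newton_kernel w > 0"
proof -
  have "1 + (norm w)\<^sup>2 > 0" by (rule add_pos_nonneg) auto
  then show ?thesis by (simp add: newton_kernel_def)
qed

lemma newton_kernel_measurable [measurable]: "newton_kernel \<in> borel_measurable borel"
  unfolding newton_kernel_def[abs_def] by measurable

text \<open>
  The product bound \<open>(1 + x\<^sup>2) * (1 + y\<^sup>2) \<le> (1 + x\<^sup>2 + y\<^sup>2)\<^sup>2\<close> reduces integrability to the
  one-dimensional Cauchy density.
\<close>
lemma integrable_newton_kernel: "integrable lborel newton_kernel"
proof (rule integrableI_nonneg)
  let ?q = "\<lambda>x::real. ennreal (inverse (1 + x\<^sup>2))"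
  have "integrable lborel (\<lambda>x::real. inverse (1 + x\<^sup>2))"
    using integrable_inverse_1_plus_square by (simp add: set_integrable_def)
  then have fin: "(\<integral>\<^sup>+x. ?q x \<partial>lborel) < \<infinity>"
    by (simp add: integrable_iff_bounded)
  have "(\<integral>\<^sup>+w. ennreal (newton_kernel w) \<partial>lborel)
      = (\<integral>\<^sup>+x. \<integral>\<^sup>+y. ennreal (newton_kernel (Complex x y)) \<partial>lborel \<partial>lborel)"
    by (rule nn_integral_complex) simp
  also have "\<dots> \<le> (\<integral>\<^sup>+x. \<integral>\<^sup>+y. 2 * ?q x * ?q y \<partial>lborel \<partial>lborel)"
  proof (intro nn_integral_mono)
    fix x y :: real
    have pos: "1 + x\<^sup>2 > 0" "1 + y\<^sup>2 > 0" by (auto intro: add_pos_nonneg)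
    have "(1 + x\<^sup>2) * (1 + y\<^sup>2) \<le> (1 + (x\<^sup>2 + y\<^sup>2)) * (1 + (x\<^sup>2 + y\<^sup>2))"
      by (intro mult_mono) auto
    then have "newton_kernel (Complex x y) \<le> 2 / ((1 + x\<^sup>2) * (1 + y\<^sup>2))"
      unfolding newton_kernel_def cmod_power2 using pos
      by (intro divide_left_mono) (auto simp: power2_eq_square[of "1 + _"] intro!: mult_pos_pos add_pos_nonneg)
    also have "\<dots> = 2 * inverse (1 + x\<^sup>2) * inverse (1 + y\<^sup>2)"
      by (simp add: divide_simps)
    finally show "ennreal (newton_kernel (Complex x y)) \<le> 2 * ?q x * ?q y"
      using pos by (simp add: ennreal_mult[symmetric] ennreal_leI flip: ennreal_numeral)
  qed
  also have "\<dots> = (\<integral>\<^sup>+x. 2 * ?q x * (\<integral>\<^sup>+y. ?q y \<partial>lborel) \<partial>lborel)"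
    by (intro nn_integral_cong nn_integral_cmult) simp
  also have "\<dots> = 2 * (\<integral>\<^sup>+x. ?q x \<partial>lborel) * (\<integral>\<^sup>+y. ?q y \<partial>lborel)"
    by (simp add: nn_integral_multc nn_integral_cmult)
  also have "\<dots> < \<infinity>" using fin by (simp add: ennreal_mult_less_top)
  finally show "(\<integral>\<^sup>+w. ennreal (newton_kernel w) \<partial>lborel) < \<infinity>" .
qed (auto simp: less_imp_le[OF newton_kernel_pos])

lemma newton_const_pos: "newton_const > 0"
proof -
  have "newton_const \<ge> 0"
    unfolding newton_const_def by (rule Bochner_Integration.integral_nonneg) (simp add: less_imp_le[OF newton_kernel_pos])
  moreover have "newton_const \<noteq> 0"
  proof
    assume "newton_const = 0"
    then have "AE w in lborel. newton_kernel w = 0"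
      unfolding newton_const_def
      by (subst (asm) integral_nonneg_eq_0_iff_AE)
         (auto simp: less_imp_le[OF newton_kernel_pos] integrable_newton_kernel)
    then have "AE w::complex in lborel. False"
      by eventually_elim (use newton_kernel_pos in \<open>auto simp: less_le\<close>)
    then show False
      by (simp add: AE_iff_null null_sets_def)
  qed
  ultimately show ?thesis by simp
qed

text \<open>
  Twice differentiable functions vanishing off a disc. The partial derivatives are parameters of
  the locale because the concrete functions come with explicit formulas for them.
\<close>
locale C2_compact_support =
  fixes f fx fy fxx fyy :: "complex \<Rightarrow> real" and L :: real
  assumes fx: "\<And>x y. ((\<lambda>x. f (Complex x y)) has_real_derivative fx (Complex x y)) (at x)"
    and fy: "\<And>x y. ((\<lambda>y. f (Complex x y)) has_real_derivative fy (Complex x y)) (at y)"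
    and fxx: "\<And>x y. ((\<lambda>x. fx (Complex x y)) has_real_derivative fxx (Complex x y)) (at x)"
    and fyy: "\<And>x y. ((\<lambda>y. fy (Complex x y)) has_real_derivative fyy (Complex x y)) (at y)"
    and cont_f: "continuous_on UNIV f"
    and cont_fxx: "continuous_on UNIV fxx" and cont_fyy: "continuous_on UNIV fyy"
    and L_pos: "L > 0"
    and vanish: "\<And>z. norm z \<ge> L \<Longrightarrow> f z = 0 \<and> fx z = 0 \<and> fy z = 0 \<and> fxx z = 0 \<and> fyy z = 0"
begin

lemma f_measurable [measurable]: "f \<in> borel_measurable borel" "fxx \<in> borel_measurable borel"
    "fyy \<in> borel_measurable borel"
  using cont_f cont_fxx cont_fyy by (auto intro: borel_measurable_continuous_onI)

lemma continuous_Complex: "continuous_on UNIV (\<lambda>x. Complex x y)" "continuous_on UNIV (\<lambda>y. Complex x y)"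
  by (auto intro!: continuous_intros simp: Complex_eq)

text \<open>
  Green's second identity on the plane, obtained by integrating by parts along horizontal and along
  vertical lines; compact support of \<open>f\<close> removes all boundary terms.
\<close>
lemma green:
  fixes v vx vy vxx vyy :: "complex \<Rightarrow> real"
  assumes vx: "\<And>x y. ((\<lambda>x. v (Complex x y)) has_real_derivative vx (Complex x y)) (at x)"
    and vy: "\<And>x y. ((\<lambda>y. v (Complex x y)) has_real_derivative vy (Complex x y)) (at y)"
    and vxx: "\<And>x y. ((\<lambda>x. vx (Complex x y)) has_real_derivative vxx (Complex x y)) (at x)"
    and vyy: "\<And>x y. ((\<lambda>y. vy (Complex x y)) has_real_derivative vyy (Complex x y)) (at y)"
    and cont: "continuous_on UNIV v" "continuous_on UNIV vxx" "continuous_on UNIV vyy"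
  shows "(\<integral>z. (fxx z + fyy z) * v z \<partial>lborel) = (\<integral>z. f z * (vxx z + vyy z) \<partial>lborel)"
proof -
  have slice: "continuous_on UNIV (\<lambda>x. g (Complex x y))" "continuous_on UNIV (\<lambda>y. g (Complex x y))"
    if "continuous_on UNIV g" for g :: "complex \<Rightarrow> real" and x y
    using that by (auto intro!: continuous_on_compose2[OF that] continuous_Complex)
  have int: "integrable lborel (\<lambda>z. fxx z * v z - f z * vxx z)" "integrable lborel (\<lambda>z. fyy z * v z - f z * vyy z)"
       "integrable lborel (\<lambda>z. (fxx z + fyy z) * v z)" "integrable lborel (\<lambda>z. f z * (vxx z + vyy z))"
    using cont cont_f cont_fxx cont_fyy vanish
    by (auto intro!: integrable_continuous_cball[where L = L] continuous_intros)
  have "(\<integral>x. fxx (Complex x y) * v (Complex x y) - f (Complex x y) * vxx (Complex x y) \<partial>lborel) = 0" for y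
    using vanish abs_Re_le_cmod[of "Complex _ y"]
    by (intro integral_by_parts_twice[OF fx fxx vx vxx slice(1)[OF cont_fxx] slice(1)[OF cont(2)], of L])
       (metis complex.sel(1) order_trans)
  then have 1: "(\<integral>z. fxx z * v z - f z * vxx z \<partial>lborel) = 0"
    by (subst integral_complex(2)[OF int(1)]) simp
  have "(\<integral>y. fyy (Complex x y) * v (Complex x y) - f (Complex x y) * vyy (Complex x y) \<partial>lborel) = 0" for x
    using vanish abs_Im_le_cmod[of "Complex x _"]
    by (intro integral_by_parts_twice[OF fy fyy vy vyy slice(2)[OF cont_fyy] slice(2)[OF cont(3)], of L])
       (metis complex.sel(2) order_trans)
  then have 2: "(\<integral>z. fyy z * v z - f z * vyy z \<partial>lborel) = 0"
    by (subst integral_complex(1)[OF int(2)]) simp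
  have "(\<integral>z. (fxx z + fyy z) * v z \<partial>lborel) - (\<integral>z. f z * (vxx z + vyy z) \<partial>lborel)
      = (\<integral>z. (fxx z * v z - f z * vxx z) + (fyy z * v z - f z * vyy z) \<partial>lborel)"
    using int(3,4) by (subst Bochner_Integration.integral_diff[symmetric]) (auto simp: algebra_simps)
  also have "\<dots> = 0"
    using int(1,2) 1 2 by (subst Bochner_Integration.integral_add) auto
  finally show ?thesis by simp
qed

text \<open>
  The function \<open>ln ((norm (t - z))\<^sup>2 + e\<^sup>2) / 2\<close> is smooth, so Green's identity moves the Laplacian
  onto it. The result is an approximate identity at scale \<open>e\<close>, and the substitution
  \<open>z = t + e *\<^sub>R w\<close> brings it to the fixed kernel.
\<close>
lemma green_regularized_log:
  fixes t :: complex and e :: real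
  assumes "e > 0"
  shows "(\<integral>z. (fxx z + fyy z) * (ln ((norm (t - z))\<^sup>2 + e\<^sup>2) / 2) \<partial>lborel)
      = (\<integral>w. f (t + e *\<^sub>R w) * newton_kernel w \<partial>lborel)"
proof -
  define q where "q z = (Re z - Re t)\<^sup>2 + (Im z - Im t)\<^sup>2 + e\<^sup>2" for z
  have q: "q z > 0" for z
    using assms by (auto simp: q_def intro!: add_nonneg_pos)
  have q': "q z \<noteq> 0" for z using q[of z] by simp
  have q_norm: "q z = (norm (t - z))\<^sup>2 + e\<^sup>2" for z
    by (simp add: q_def cmod_power2 power2_commute)
  have qx: "((\<lambda>x. q (Complex x y)) has_real_derivative 2 * (x - Re t)) (at x)" for x y
    unfolding q_def by (auto intro!: derivative_eq_intros)
  have qy: "((\<lambda>y. q (Complex x y)) has_real_derivative 2 * (y - Im t)) (at y)" for x y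
    unfolding q_def by (auto intro!: derivative_eq_intros)
  have contq: "continuous_on UNIV q"
    unfolding q_def by (intro continuous_intros)
  have [measurable]: "q \<in> borel_measurable borel"
    using contq by (rule borel_measurable_continuous_onI)
  define vxx where "vxx z = 1 / q z - 2 * (Re z - Re t)\<^sup>2 / (q z)\<^sup>2" for z
  define vyy where "vyy z = 1 / q z - 2 * (Im z - Im t)\<^sup>2 / (q z)\<^sup>2" for z
  have "(\<integral>z. (fxx z + fyy z) * (ln (q z) / 2) \<partial>lborel) = (\<integral>z. f z * (vxx z + vyy z) \<partial>lborel)"
  proof (rule green)
    show "((\<lambda>x. ln (q (Complex x y)) / 2) has_real_derivative
        (\<lambda>z. (Re z - Re t) / q z) (Complex x y)) (at x)" for x y
      by (auto intro!: derivative_eq_intros qx q simp: field_simps q')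
    show "((\<lambda>y. ln (q (Complex x y)) / 2) has_real_derivative
        (\<lambda>z. (Im z - Im t) / q z) (Complex x y)) (at y)" for x y
      by (auto intro!: derivative_eq_intros qy q simp: field_simps q')
    show "((\<lambda>x. (Re (Complex x y) - Re t) / q (Complex x y)) has_real_derivative vxx (Complex x y)) (at x)" for x y
      using q'[of "Complex x y"]
      by (auto intro!: derivative_eq_intros qx simp: vxx_def field_simps power2_eq_square)
    show "((\<lambda>y. (Im (Complex x y) - Im t) / q (Complex x y)) has_real_derivative vyy (Complex x y)) (at y)" for x y
      using q'[of "Complex x y"]
      by (auto intro!: derivative_eq_intros qy simp: vyy_def field_simps power2_eq_square)
    show "continuous_on UNIV (\<lambda>z. ln (q z) / 2)" "continuous_on UNIV vxx" "continuous_on UNIV vyy"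
      unfolding vxx_def vyy_def by (auto intro!: continuous_intros contq simp: q')
  qed
  also have "\<dots> = (\<integral>z. f z * (2 * e\<^sup>2 / (q z)\<^sup>2) \<partial>lborel)"
  proof (intro Bochner_Integration.integral_cong refl)
    fix z
    have "vxx z + vyy z = (2 * q z - 2 * ((Re z - Re t)\<^sup>2 + (Im z - Im t)\<^sup>2)) / (q z)\<^sup>2"
      using q'[of z] by (simp add: vxx_def vyy_def field_simps power2_eq_square)
    then show "f z * (vxx z + vyy z) = f z * (2 * e\<^sup>2 / (q z)\<^sup>2)"
      by (simp add: q_def)
  qed
  also have "\<dots> = e\<^sup>2 * (\<integral>w. f (t + e *\<^sub>R w) * (2 * e\<^sup>2 / (q (t + e *\<^sub>R w))\<^sup>2) \<partial>lborel)"
    using assms by (intro integral_complex_affine) auto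
  also have "\<dots> = (\<integral>w. e\<^sup>2 * (f (t + e *\<^sub>R w) * (2 * e\<^sup>2 / (q (t + e *\<^sub>R w))\<^sup>2)) \<partial>lborel)"
    by (rule integral_mult_right_zero [symmetric])
  also have "\<dots> = (\<integral>w. f (t + e *\<^sub>R w) * newton_kernel w \<partial>lborel)"
  proof (intro Bochner_Integration.integral_cong refl)
    fix w :: complex
    define S where "S = 1 + (norm w)\<^sup>2"
    have "q (t + e *\<^sub>R w) = e\<^sup>2 * S" unfolding S_def
      unfolding q_norm using assms by (simp add: power_mult_distrib algebra_simps)
    then show "e\<^sup>2 * (f (t + e *\<^sub>R w) * (2 * e\<^sup>2 / (q (t + e *\<^sub>R w))\<^sup>2)) = f (t + e *\<^sub>R w) * newton_kernel w"
      using assms by (simp add: newton_kernel_def S_def power2_eq_square)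
  qed
  finally show ?thesis by (simp add: q_norm)
qed

lemma bounded_of_continuous_vanishing:
  fixes g :: "complex \<Rightarrow> real"
  assumes "continuous_on UNIV g" "\<And>z. norm z \<ge> L \<Longrightarrow> g z = 0"
  obtains B where "B \<ge> 0" "\<And>z. \<bar>g z\<bar> \<le> B * indicator (cball 0 L) z"
proof -
  have "bounded (g ` cball 0 L)"
    using assms(1) by (intro compact_imp_bounded compact_continuous_image) (auto intro: continuous_on_subset)
  then obtain B where B: "B > 0" "\<And>z. norm z \<le> L \<Longrightarrow> \<bar>g z\<bar> \<le> B"
    unfolding bounded_pos by auto
  show ?thesis
    using B assms(2) by (intro that[of B]) (auto simp: indicator_def)
qed

text \<open>
  The logarithm is, up to the constant, the fundamental solution of the Laplacian: let the
  regularisation parameter tend to \<open>0\<close>. On the left, domination comes from the local integrability of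
  the logarithm; on the right, from the integrability of the kernel and the boundedness of \<open>f\<close>.
\<close>
lemma newtonian_potential:
  "(\<integral>z. (fxx z + fyy z) * ln (norm (t - z)) \<partial>lborel) = newton_const * f t"
proof -
  define e where "e n = 1 / real (Suc n)" for n
  have e: "e n > 0" "e n \<le> 1" for n by (auto simp: e_def)
  have e0: "e \<longlonglongrightarrow> 0" unfolding e_def by (rule LIMSEQ_Suc[OF lim_1_over_n])
  obtain G where G: "G \<ge> 0" "\<And>z. \<bar>fxx z + fyy z\<bar> \<le> G * indicator (cball 0 L) z"
    by (rule bounded_of_continuous_vanishing[of "\<lambda>z. fxx z + fyy z"])
       (use vanish in \<open>auto intro!: continuous_intros cont_fxx cont_fyy\<close>)
  obtain B where B: "B \<ge> 0" "\<And>z. \<bar>f z\<bar> \<le> B * indicator (cball 0 L) z"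
    by (rule bounded_of_continuous_vanishing[of f]) (use vanish cont_f in auto)
  define C where "C = ln (1 + (norm t + L)\<^sup>2) / 2"
  have "(\<lambda>n. \<integral>z. (fxx z + fyy z) * (ln ((norm (t - z))\<^sup>2 + (e n)\<^sup>2) / 2) \<partial>lborel)
      \<longlonglongrightarrow> (\<integral>z. (fxx z + fyy z) * ln (norm (t - z)) \<partial>lborel)"
  proof (rule integral_dominated_convergence[where
        w = "\<lambda>z. G * (\<bar>ln (norm (t - z))\<bar> * indicator (cball 0 L) z) + G * C * indicator (cball 0 L) z"])
    show "integrable lborel (\<lambda>z. G * (\<bar>ln (norm (t - z))\<bar> * indicator (cball 0 L) z) + G * C * indicator (cball 0 L) z)"
      using L_pos emeasure_lborel_cball_finite[of "0::complex" L]
      by (intro Bochner_Integration.integrable_add integrable_mult_right integrable_ln_cball) auto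
    have AE_t: "AE z in lborel. z \<noteq> t" by (rule AE_lborel_singleton)
    show "AE z in lborel. (\<lambda>n. (fxx z + fyy z) * (ln ((norm (t - z))\<^sup>2 + (e n)\<^sup>2) / 2))
        \<longlonglongrightarrow> (fxx z + fyy z) * ln (norm (t - z))"
      using AE_t
    proof eventually_elim
      case (elim z)
      then have d: "norm (t - z) > 0" by simp
      have "(\<lambda>n. ln ((norm (t - z))\<^sup>2 + (e n)\<^sup>2) / 2) \<longlonglongrightarrow> ln ((norm (t - z))\<^sup>2 + 0\<^sup>2) / 2"
        using d by (intro tendsto_intros e0) auto
      moreover have "ln ((norm (t - z))\<^sup>2 + 0\<^sup>2) / 2 = ln (norm (t - z))"
        using d by (simp add: ln_realpow)
      ultimately show ?case by (intro tendsto_mult) auto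
    qed
    show "AE z in lborel. norm ((fxx z + fyy z) * (ln ((norm (t - z))\<^sup>2 + (e n)\<^sup>2) / 2))
        \<le> G * (\<bar>ln (norm (t - z))\<bar> * indicator (cball 0 L) z) + G * C * indicator (cball 0 L) z" for n
      using AE_t
    proof eventually_elim
      case (elim z)
      then have d: "norm (t - z) > 0" by simp
      show ?case
      proof (cases "z \<in> cball 0 L")
        case True
        have "2 * ln (norm (t - z)) = ln ((norm (t - z))\<^sup>2)"
          using d by (simp add: ln_realpow)
        also have "\<dots> \<le> ln ((norm (t - z))\<^sup>2 + (e n)\<^sup>2)"
          using d by (subst ln_le_cancel_iff) (auto intro: add_pos_nonneg)
        finally have lower: "ln (norm (t - z)) \<le> ln ((norm (t - z))\<^sup>2 + (e n)\<^sup>2) / 2" by simp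
        have "norm (t - z) \<le> norm t + L"
          using True norm_triangle_ineq4[of t z] by simp
        then have "(norm (t - z))\<^sup>2 + (e n)\<^sup>2 \<le> (norm t + L)\<^sup>2 + 1"
          using e[of n] by (intro add_mono power_mono) (auto simp: power_le_one)
        then have upper: "ln ((norm (t - z))\<^sup>2 + (e n)\<^sup>2) / 2 \<le> C"
          using d unfolding C_def
          by (intro divide_right_mono, subst ln_le_cancel_iff) (auto intro: add_pos_nonneg)
        have "C \<ge> 0" by (simp add: C_def)
        then have "\<bar>ln ((norm (t - z))\<^sup>2 + (e n)\<^sup>2) / 2\<bar> \<le> \<bar>ln (norm (t - z))\<bar> + C"
          using lower upper by linarith
        then have "\<bar>fxx z + fyy z\<bar> * \<bar>ln ((norm (t - z))\<^sup>2 + (e n)\<^sup>2) / 2\<bar> \<le> G * (\<bar>ln (norm (t - z))\<bar> + C)"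
          using G(1) G(2)[of z] True by (intro mult_mono) auto
        also have "\<dots> = G * (\<bar>ln (norm (t - z))\<bar> * indicator (cball 0 L) z) + G * C * indicator (cball 0 L) z"
          using True by (simp add: algebra_simps)
        finally show ?thesis by (simp only: real_norm_def abs_mult)
      qed (use G(2)[of z] in simp)
    qed
  qed auto
  moreover have "(\<lambda>n. \<integral>z. (fxx z + fyy z) * (ln ((norm (t - z))\<^sup>2 + (e n)\<^sup>2) / 2) \<partial>lborel)
      \<longlonglongrightarrow> (\<integral>w. f t * newton_kernel w \<partial>lborel)"
    unfolding green_regularized_log[OF e(1)]
  proof (rule integral_dominated_convergence[where w = "\<lambda>w. B * newton_kernel w"])
    show "integrable lborel (\<lambda>w. B * newton_kernel w)"
      by (intro integrable_mult_right integrable_newton_kernel)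
    show "AE w in lborel. (\<lambda>n. f (t + e n *\<^sub>R w) * newton_kernel w) \<longlonglongrightarrow> f t * newton_kernel w"
    proof (rule AE_I2)
      fix w
      have "(\<lambda>n. t + e n *\<^sub>R w) \<longlonglongrightarrow> t + 0 *\<^sub>R w" by (intro tendsto_intros e0)
      moreover have "isCont f t" using cont_f by (simp add: continuous_on_eq_continuous_at)
      ultimately have "(\<lambda>n. f (t + e n *\<^sub>R w)) \<longlonglongrightarrow> f t"
        by (intro isCont_tendsto_compose[of t f]) auto
      then show "(\<lambda>n. f (t + e n *\<^sub>R w) * newton_kernel w) \<longlonglongrightarrow> f t * newton_kernel w"
        by (intro tendsto_mult) auto
    qed
    show "AE w in lborel. norm (f (t + e n *\<^sub>R w) * newton_kernel w) \<le> B * newton_kernel w" for n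
    proof (rule AE_I2)
      fix w
      have "\<bar>f (t + e n *\<^sub>R w)\<bar> \<le> B"
        using B(1) B(2)[of "t + e n *\<^sub>R w"] by (cases "t + e n *\<^sub>R w \<in> cball 0 L") auto
      then show "norm (f (t + e n *\<^sub>R w) * newton_kernel w) \<le> B * newton_kernel w"
        using newton_kernel_pos[of w] by (simp add: abs_mult mult_right_mono)
    qed
  qed auto
  ultimately have "(\<integral>z. (fxx z + fyy z) * ln (norm (t - z)) \<partial>lborel) = (\<integral>w. f t * newton_kernel w \<partial>lborel)"
    by (rule LIMSEQ_unique)
  then show ?thesis by (simp add: newton_const_def mult.commute)
qed

end

section \<open>Smooth cutoffs\<close>

text \<open>
  Clamping the argument to the unit interval turns a polynomial into a function that is constant
  outside it.
\<close>
definition unit_clamp :: "real \<Rightarrow> real" where "unit_clamp s = max 0 (min 1 s)"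

lemma continuous_unit_clamp: "continuous_on UNIV unit_clamp"
  unfolding unit_clamp_def[abs_def] by (intro continuous_intros)

text \<open>
  At the end points the derivative of \<open>g\<close> vanishes and clamping is a contraction, so the kink of the
  clamp is invisible to first order. Applying this twice makes the quintic step below twice
  continuously differentiable.
\<close>
lemma has_derivative_unit_clamp:
  fixes g g' :: "real \<Rightarrow> real"
  assumes g: "\<And>u. (g has_real_derivative g' u) (at u)" and "g' 0 = 0" "g' 1 = 0"
  shows "((\<lambda>s. g (unit_clamp s)) has_real_derivative g' (unit_clamp s)) (at s)"
proof (cases "s \<in> {0<..<1}")
  case True
  then have "(g has_real_derivative g' (unit_clamp s)) (at s)"
    using g[of s] by (simp add: unit_clamp_def)
  then show ?thesis
    by (rule has_field_derivative_transform_within_open[of _ _ _ "{0<..<1}"])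
       (use True in \<open>auto simp: unit_clamp_def\<close>)
next
  case False
  define c where "c = unit_clamp s"
  have c0: "g' c = 0" using False assms(2,3) by (auto simp: c_def unit_clamp_def)
  obtain k where k: "\<And>z. g z - g c = k z * (z - c)" "isCont k c" "k c = 0"
    using CARAT_DERIV[of g "g' c" c] g[of c] c0 by auto
  have "isCont unit_clamp s"
    using continuous_unit_clamp by (simp add: continuous_on_eq_continuous_at)
  then have "(\<lambda>y. k (unit_clamp y)) \<midarrow>s\<rightarrow> k c"
    using k(2) isCont_tendsto_compose[of c k unit_clamp "at s"] unfolding c_def isCont_def by simp
  then have lim: "(\<lambda>y. \<bar>k (unit_clamp y)\<bar>) \<midarrow>s\<rightarrow> 0" using k(3) tendsto_rabs_zero by metis
  have "(\<lambda>y. (g (unit_clamp y) - g c) / (y - s)) \<midarrow>s\<rightarrow> 0"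
  proof (rule Lim_null_comparison[OF always_eventually lim], rule allI)
    fix y
    have lip: "\<bar>unit_clamp y - c\<bar> \<le> \<bar>y - s\<bar>" by (auto simp: c_def unit_clamp_def)
    show "norm ((g (unit_clamp y) - g c) / (y - s)) \<le> \<bar>k (unit_clamp y)\<bar>"
    proof (cases "y = s")
      case False
      have "\<bar>k (unit_clamp y)\<bar> * \<bar>unit_clamp y - c\<bar> \<le> \<bar>k (unit_clamp y)\<bar> * \<bar>y - s\<bar>"
        by (intro mult_left_mono lip) simp
      then show ?thesis using False by (simp add: k(1) abs_mult divide_le_eq)
    qed simp
  qed
  then show ?thesis using c0 by (simp add: has_field_derivative_iff c_def)
qed

text \<open>
  The quintic is the polynomial of least degree that goes from \<open>1\<close> at \<open>u = 0\<close> to \<open>0\<close> at \<open>u = 1\<close> with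
  vanishing first and second derivatives at both ends.
\<close>
definition smooth_step :: "real \<Rightarrow> real" where
  "smooth_step s = (let u = unit_clamp s in 1 - 10 * u ^ 3 + 15 * u ^ 4 - 6 * u ^ 5)"

definition smooth_step' :: "real \<Rightarrow> real" where
  "smooth_step' s = (let u = unit_clamp s in - 30 * u ^ 2 * (1 - u) ^ 2)"

definition smooth_step'' :: "real \<Rightarrow> real" where
  "smooth_step'' s = (let u = unit_clamp s in - 60 * u * (1 - u) * (1 - 2 * u))"

lemma smooth_step_deriv [derivative_intros]:
  "(smooth_step has_real_derivative smooth_step' s) (at s)"
  unfolding smooth_step_def[abs_def] smooth_step'_def Let_def
  by (rule has_derivative_unit_clamp)
     (auto intro!: derivative_eq_intros simp: power2_eq_square power3_eq_cube power4_eq_xxxx algebra_simps)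

lemma smooth_step'_deriv [derivative_intros]:
  "(smooth_step' has_real_derivative smooth_step'' s) (at s)"
  unfolding smooth_step'_def[abs_def] smooth_step''_def Let_def
  by (rule has_derivative_unit_clamp)
     (auto intro!: derivative_eq_intros simp: power2_eq_square algebra_simps)

lemma continuous_smooth_step [continuous_intros]:
  assumes "continuous_on A f"
  shows "continuous_on A (\<lambda>x. smooth_step (f x))" "continuous_on A (\<lambda>x. smooth_step' (f x))"
    "continuous_on A (\<lambda>x. smooth_step'' (f x))"
  unfolding smooth_step_def smooth_step'_def smooth_step''_def Let_def unit_clamp_def
  by (intro continuous_intros assms)+

lemma smooth_step_bounds: "0 \<le> smooth_step s" "smooth_step s \<le> 1"
proof -
  define u where "u = unit_clamp s"
  have u: "0 \<le> u" "u \<le> 1" by (auto simp: u_def unit_clamp_def)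
  have "smooth_step s = (1 - u) ^ 3 * (1 + 3 * u + 6 * u ^ 2)"
    unfolding smooth_step_def Let_def u_def[symmetric]
    by (simp add: power2_eq_square power3_eq_cube power_numeral_reduce algebra_simps)
  then show "0 \<le> smooth_step s" using u by simp
  have "1 - smooth_step s = u ^ 3 * ((1 - u) * (10 - 5 * u) + u ^ 2)"
    unfolding smooth_step_def Let_def u_def[symmetric]
    by (simp add: power2_eq_square power3_eq_cube power_numeral_reduce algebra_simps)
  also have "\<dots> \<ge> 0" using u by (intro mult_nonneg_nonneg add_nonneg_nonneg) auto
  finally show "smooth_step s \<le> 1" by simp
qed

lemma smooth_step'_bound: "\<bar>smooth_step' s\<bar> \<le> 30"
proof -
  define u where "u = unit_clamp s"
  have u: "0 \<le> u" "u \<le> 1" by (auto simp: u_def unit_clamp_def)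
  have "u ^ 2 * (1 - u) ^ 2 \<le> 1 * 1"
    using u by (intro mult_mono power_le_one) auto
  then show ?thesis
    unfolding smooth_step'_def Let_def u_def[symmetric] by (simp add: abs_mult)
qed

lemma smooth_step''_bound: "\<bar>smooth_step'' s\<bar> \<le> 60"
proof -
  define u where "u = unit_clamp s"
  have u: "0 \<le> u" "u \<le> 1" by (auto simp: u_def unit_clamp_def)
  have "\<bar>u\<bar> * \<bar>1 - u\<bar> * \<bar>1 - 2 * u\<bar> \<le> 1 * 1 * 1"
    using u by (intro mult_mono) auto
  then show ?thesis
    unfolding smooth_step''_def Let_def u_def[symmetric] by (simp add: abs_mult)
qed

lemma smooth_step_left: "s \<le> 0 \<Longrightarrow> smooth_step s = 1 \<and> smooth_step' s = 0 \<and> smooth_step'' s = 0"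
  by (simp add: smooth_step_def smooth_step'_def smooth_step''_def unit_clamp_def)

lemma smooth_step_right: "s \<ge> 1 \<Longrightarrow> smooth_step s = 0 \<and> smooth_step' s = 0 \<and> smooth_step'' s = 0"
  by (simp add: smooth_step_def smooth_step'_def smooth_step''_def unit_clamp_def)

text \<open>
  A radial cutoff that is \<open>1\<close> on the disc of radius \<open>r\<close> about \<open>c\<close> and \<open>0\<close> off the disc of radius
  \<open>r + h\<close>. It is a function of the squared distance to \<open>c\<close>, which keeps it smooth at the centre even
  for \<open>r = 0\<close>, and its derivatives are of size \<open>1 / h\<close> and \<open>1 / h\<^sup>2\<close> uniformly in \<open>r\<close>.
\<close>
locale annular_cutoff =
  fixes c :: complex and r h :: real
  assumes r: "r \<ge> 0" and h: "h > 0"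
begin

definition width :: real where "width = (r + h)\<^sup>2 - r\<^sup>2"

definition level :: "complex \<Rightarrow> real" where
  "level z = ((Re z - Re c)\<^sup>2 + (Im z - Im c)\<^sup>2 - r\<^sup>2) / width"

definition cutoff :: "complex \<Rightarrow> real" where
  "cutoff z = smooth_step (level z)"

text \<open>
  The argument \<open>e\<close> is the coordinate function, \<^const>\<open>Re\<close> or \<^const>\<open>Im\<close>, so that one
  formula serves both directions.
\<close>
definition partial_deriv :: "(complex \<Rightarrow> real) \<Rightarrow> complex \<Rightarrow> real" where
  "partial_deriv e z = smooth_step' (level z) * (2 * (e z - e c) / width)"

definition partial_deriv2 :: "(complex \<Rightarrow> real) \<Rightarrow> complex \<Rightarrow> real" where
  "partial_deriv2 e z = smooth_step'' (level z) * (2 * (e z - e c) / width)\<^sup>2 + smooth_step' (level z) * (2 / width)"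

lemma width_ge: "width \<ge> h * (r + h)" "width \<ge> h\<^sup>2" "width > 0"
proof -
  have w: "width = h * (r + h) + h * r" by (simp add: width_def power2_eq_square algebra_simps)
  have "h * r \<ge> 0" "h * (r + h) \<ge> h * h" using r h by auto
  then show "width \<ge> h * (r + h)" "width \<ge> h\<^sup>2" "width > 0"
    using h w mult_pos_pos[OF h h] unfolding power2_eq_square by linarith+
qed

lemma level_norm: "level z = ((norm (z - c))\<^sup>2 - r\<^sup>2) / width"
  by (simp add: level_def cmod_power2)

lemma level_le_0: "norm (z - c) \<le> r \<Longrightarrow> level z \<le> 0"
  using width_ge(3) r by (auto simp: level_norm divide_le_0_iff intro!: power_mono)

lemma level_ge_1: "norm (z - c) \<ge> r + h \<Longrightarrow> level z \<ge> 1"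
  using width_ge(3) r h power_mono[of "r + h" "norm (z - c)" 2]
  by (auto simp: level_norm width_def le_divide_eq)

lemma cutoff_bounds: "0 \<le> cutoff z" "cutoff z \<le> 1"
  by (auto simp: cutoff_def smooth_step_bounds)

lemma cutoff_inside: "norm (z - c) \<le> r \<Longrightarrow> cutoff z = 1 \<and> partial_deriv e z = 0 \<and> partial_deriv2 e z = 0"
  using smooth_step_left[OF level_le_0] by (simp add: cutoff_def partial_deriv_def partial_deriv2_def)

lemma cutoff_outside: "norm (z - c) \<ge> r + h \<Longrightarrow> cutoff z = 0 \<and> partial_deriv e z = 0 \<and> partial_deriv2 e z = 0"
  using smooth_step_right[OF level_ge_1] by (simp add: cutoff_def partial_deriv_def partial_deriv2_def)

lemma cutoff_deriv:
  "((\<lambda>x. cutoff (Complex x y)) has_real_derivative partial_deriv Re (Complex x y)) (at x)"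
  "((\<lambda>y. cutoff (Complex x y)) has_real_derivative partial_deriv Im (Complex x y)) (at y)"
  "((\<lambda>x. partial_deriv Re (Complex x y)) has_real_derivative partial_deriv2 Re (Complex x y)) (at x)"
  "((\<lambda>y. partial_deriv Im (Complex x y)) has_real_derivative partial_deriv2 Im (Complex x y)) (at y)"
proof -
  have lx: "((\<lambda>x. level (Complex x y)) has_real_derivative 2 * (x - Re c) / width) (at x)" for x y
    unfolding level_def using width_ge(3) by (auto intro!: derivative_eq_intros)
  have ly: "((\<lambda>y. level (Complex x y)) has_real_derivative 2 * (y - Im c) / width) (at y)" for x y
    unfolding level_def using width_ge(3) by (auto intro!: derivative_eq_intros)
  note chain = DERIV_chain2[OF smooth_step_deriv] DERIV_chain2[OF smooth_step'_deriv]
  show "((\<lambda>x. cutoff (Complex x y)) has_real_derivative partial_deriv Re (Complex x y)) (at x)"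
    unfolding cutoff_def partial_deriv_def using chain(1)[OF lx] by simp
  show "((\<lambda>y. cutoff (Complex x y)) has_real_derivative partial_deriv Im (Complex x y)) (at y)"
    unfolding cutoff_def partial_deriv_def using chain(1)[OF ly] by simp
  show "((\<lambda>x. partial_deriv Re (Complex x y)) has_real_derivative partial_deriv2 Re (Complex x y)) (at x)"
    unfolding partial_deriv_def partial_deriv2_def using width_ge(3)
    by (auto intro!: derivative_eq_intros chain(2)[OF lx] simp: power2_eq_square add_divide_distrib mult_ac)
  show "((\<lambda>y. partial_deriv Im (Complex x y)) has_real_derivative partial_deriv2 Im (Complex x y)) (at y)"
    unfolding partial_deriv_def partial_deriv2_def using width_ge(3)
    by (auto intro!: derivative_eq_intros chain(2)[OF ly] simp: power2_eq_square add_divide_distrib mult_ac)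
qed

lemma cutoff_continuous: "continuous_on A cutoff"
  "continuous_on A e \<Longrightarrow> continuous_on A (partial_deriv e)"
  "continuous_on A e \<Longrightarrow> continuous_on A (partial_deriv2 e)"
  using width_ge(3) unfolding cutoff_def[abs_def] partial_deriv_def[abs_def] partial_deriv2_def[abs_def] level_def
  by (auto intro!: continuous_intros)

text \<open>
  The inner derivative is \<open>2 * (e z - e c) / width\<close>, where \<open>width \<ge> h * (r + h)\<close> compensates the
  distance \<open>\<bar>e z - e c\<bar> \<le> r + h\<close> on the annulus; hence the radius drops out.
\<close>
lemma partial_deriv_bounds:
  assumes "\<bar>e z - e c\<bar> \<le> norm (z - c)"
  shows "\<bar>partial_deriv e z\<bar> \<le> 60 / h" "\<bar>partial_deriv2 e z\<bar> \<le> 300 / h\<^sup>2"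
proof -
  have "\<bar>partial_deriv e z\<bar> \<le> 60 / h \<and> \<bar>partial_deriv2 e z\<bar> \<le> 300 / h\<^sup>2"
  proof (cases "norm (z - c) \<ge> r + h")
    case True
    then show ?thesis using cutoff_outside[of z e] h by simp
  next
    case False
    define q where "q = 2 * (e z - e c) / width"
    have "h * \<bar>e z - e c\<bar> \<le> h * (r + h)"
      using False assms h by (intro mult_left_mono) auto
    also have "\<dots> \<le> width" by (rule width_ge)
    finally have "h * \<bar>e z - e c\<bar> \<le> width" .
    have q: "\<bar>q\<bar> \<le> 2 / h"
    proof -
      have "\<bar>q\<bar> = 2 * \<bar>e z - e c\<bar> / width"
        using width_ge(3) by (simp only: q_def abs_divide abs_mult abs_of_pos abs_numeral)
      also have "\<dots> \<le> 2 / h"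
        using width_ge(3) h \<open>h * \<bar>e z - e c\<bar> \<le> width\<close> by (simp add: divide_simps mult.commute)
      finally show ?thesis .
    qed
    have w: "2 / width \<le> 2 / h\<^sup>2" using width_ge h by (intro divide_left_mono) auto
    have "\<bar>partial_deriv e z\<bar> = \<bar>smooth_step' (level z)\<bar> * \<bar>q\<bar>"
      by (simp add: partial_deriv_def q_def abs_mult)
    also have "\<dots> \<le> 30 * (2 / h)" by (intro mult_mono q smooth_step'_bound) auto
    finally have 1: "\<bar>partial_deriv e z\<bar> \<le> 60 / h" by simp
    have "\<bar>partial_deriv2 e z\<bar> \<le> \<bar>smooth_step'' (level z)\<bar> * \<bar>q\<bar>\<^sup>2 + \<bar>smooth_step' (level z)\<bar> * (2 / width)"
      unfolding partial_deriv2_def q_def[symmetric] using width_ge(3)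
      by (intro order_trans[OF abs_triangle_ineq]) (simp add: abs_mult)
    also have "\<dots> \<le> 60 * (2 / h)\<^sup>2 + 30 * (2 / h\<^sup>2)"
      using width_ge(3) h
      by (intro add_mono mult_mono power_mono q w smooth_step'_bound smooth_step''_bound) auto
    also have "\<dots> = 300 / h\<^sup>2" by (simp add: power_divide)
    finally show ?thesis using 1 by simp
  qed
  then show "\<bar>partial_deriv e z\<bar> \<le> 60 / h" "\<bar>partial_deriv2 e z\<bar> \<le> 300 / h\<^sup>2" by auto
qed

end

text \<open>
  The product of a cutoff for an arbitrary disc with one for a disc about the origin. The second factor
  confines the test function to a bounded region, however large the first disc is.
\<close>
locale disc_pair_cutoff =
  A: annular_cutoff c r h + B: annular_cutoff 0 s h for c :: complex and r s h :: real
begin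

definition test :: "complex \<Rightarrow> real" where
  "test z = A.cutoff z * B.cutoff z"

definition test_partial :: "(complex \<Rightarrow> real) \<Rightarrow> complex \<Rightarrow> real" where
  "test_partial e z = A.partial_deriv e z * B.cutoff z + A.cutoff z * B.partial_deriv e z"

definition test_partial2 :: "(complex \<Rightarrow> real) \<Rightarrow> complex \<Rightarrow> real" where
  "test_partial2 e z = A.partial_deriv2 e z * B.cutoff z + 2 * (A.partial_deriv e z * B.partial_deriv e z)
     + A.cutoff z * B.partial_deriv2 e z"

definition transition :: "complex set" where
  "transition = {z \<in> ball 0 (s + h). r \<le> norm (z - c) \<and> norm (z - c) \<le> r + h \<or> s \<le> norm z}"

lemma transition_measurable [measurable]: "transition \<in> sets borel"
  unfolding transition_def by simp

sublocale C2_compact_support test "test_partial Re" "test_partial Im" "test_partial2 Re" "test_partial2 Im" "s + h"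
proof
  note d = A.cutoff_deriv B.cutoff_deriv
  show "((\<lambda>x. test (Complex x y)) has_real_derivative test_partial Re (Complex x y)) (at x)" for x y
    unfolding test_def test_partial_def by (auto intro!: derivative_eq_intros d simp: algebra_simps)
  show "((\<lambda>y. test (Complex x y)) has_real_derivative test_partial Im (Complex x y)) (at y)" for x y
    unfolding test_def test_partial_def by (auto intro!: derivative_eq_intros d simp: algebra_simps)
  show "((\<lambda>x. test_partial Re (Complex x y)) has_real_derivative test_partial2 Re (Complex x y)) (at x)" for x y
    unfolding test_partial_def test_partial2_def by (auto intro!: derivative_eq_intros d simp: algebra_simps)
  show "((\<lambda>y. test_partial Im (Complex x y)) has_real_derivative test_partial2 Im (Complex x y)) (at y)" for x y
    unfolding test_partial_def test_partial2_def by (auto intro!: derivative_eq_intros d simp: algebra_simps)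
  show "continuous_on UNIV test" "continuous_on UNIV (test_partial2 Re)" "continuous_on UNIV (test_partial2 Im)"
    unfolding test_def[abs_def] test_partial2_def[abs_def]
    by (intro continuous_intros A.cutoff_continuous B.cutoff_continuous)+
  show "s + h > 0" using B.r B.h by simp
  show "test z = 0 \<and> test_partial Re z = 0 \<and> test_partial Im z = 0 \<and> test_partial2 Re z = 0 \<and> test_partial2 Im z = 0"
    if "s + h \<le> norm z" for z
    using B.cutoff_outside[of z] that by (simp add: test_def test_partial_def test_partial2_def)
qed

lemma test_bounds: "0 \<le> test z" "test z \<le> 1"
  using A.cutoff_bounds[of z] B.cutoff_bounds[of z] by (auto simp: test_def intro: mult_le_one)

lemma test_eq_1: "norm (z - c) \<le> r \<Longrightarrow> norm z \<le> s \<Longrightarrow> test z = 1"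
  using A.cutoff_inside[of z] B.cutoff_inside[of z] by (simp add: test_def)

lemma test_eq_0: "norm (z - c) \<ge> r + h \<or> norm z \<ge> s + h \<Longrightarrow> test z = 0"
  using A.cutoff_outside[of z] B.cutoff_outside[of z] by (auto simp: test_def)

lemma test_partial2_bound:
  assumes "\<bar>e z - e c\<bar> \<le> norm (z - c)" "\<bar>e z - e 0\<bar> \<le> norm z"
  shows "\<bar>test_partial2 e z\<bar> \<le> 7800 / h\<^sup>2"
proof -
  note A = A.partial_deriv_bounds[OF assms(1)]
  have B: "\<bar>B.partial_deriv e z\<bar> \<le> 60 / h" "\<bar>B.partial_deriv2 e z\<bar> \<le> 300 / h\<^sup>2"
    using B.partial_deriv_bounds[of e z] assms(2) by auto
  have h: "h > 0" by (rule A.h)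
  have c: "\<bar>A.cutoff z\<bar> \<le> 1" "\<bar>B.cutoff z\<bar> \<le> 1"
    using A.cutoff_bounds[of z] B.cutoff_bounds[of z] by auto
  have "\<bar>A.partial_deriv2 e z * B.cutoff z\<bar> \<le> (300 / h\<^sup>2) * 1"
    unfolding abs_mult using h by (intro mult_mono A c) auto
  moreover have "\<bar>A.partial_deriv e z * B.partial_deriv e z\<bar> \<le> (60 / h) * (60 / h)"
    unfolding abs_mult using h by (intro mult_mono A B) auto
  moreover have "(60 / h) * (60 / h) = 3600 / h\<^sup>2"
    by (simp add: power2_eq_square)
  moreover have "\<bar>A.cutoff z * B.partial_deriv2 e z\<bar> \<le> 1 * (300 / h\<^sup>2)"
    unfolding abs_mult using h by (intro mult_mono B c) auto
  ultimately have "\<bar>test_partial2 e z\<bar> \<le> 300 / h\<^sup>2 + 2 * (3600 / h\<^sup>2) + 300 / h\<^sup>2"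
    unfolding test_partial2_def by linarith
  then show ?thesis by simp
qed

text \<open>
  The Laplacian is of size \<open>1 / h\<^sup>2\<close>, and it lives only where one of the two cutoffs is in transition
  and the one about the origin has not yet vanished.
\<close>
lemma laplacian_test_bound:
  "\<bar>test_partial2 Re z + test_partial2 Im z\<bar> \<le> 15600 / h\<^sup>2 * indicator transition z"
proof (cases "z \<in> transition")
  case True
  have "\<bar>test_partial2 Re z\<bar> \<le> 7800 / h\<^sup>2" "\<bar>test_partial2 Im z\<bar> \<le> 7800 / h\<^sup>2"
    using abs_Re_le_cmod[of "z - c"] abs_Im_le_cmod[of "z - c"] abs_Re_le_cmod[of z] abs_Im_le_cmod[of z]
    by (auto intro!: test_partial2_bound)
  then have "\<bar>test_partial2 Re z + test_partial2 Im z\<bar> \<le> 7800 / h\<^sup>2 + 7800 / h\<^sup>2" by linarith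
  then show ?thesis using True by simp
next
  case False
  have "test_partial2 e z = 0" for e
  proof (cases "norm z \<ge> s + h")
    case True
    then show ?thesis using B.cutoff_outside[of z e] by (simp add: test_partial2_def)
  next
    case in_ball: False
    then have "norm z \<le> s" "norm (z - c) \<le> r \<or> r + h \<le> norm (z - c)"
      using \<open>z \<notin> transition\<close> by (auto simp: transition_def)
    then show ?thesis
      using B.cutoff_inside[of z e] A.cutoff_inside[of z e] A.cutoff_outside[of z e] by (auto simp: test_partial2_def)
  qed
  then show ?thesis using False by simp
qed

lemma emeasure_transition: "emeasure lborel transition \<le> ennreal (32 * (s + h) * h)"
proof -
  have sh: "s + h > 0" "s \<ge> 0" "h > 0" using A.h B.r by auto
  have "transition \<subseteq> {z \<in> cball 0 (s + h). r \<le> norm (z - c) \<and> norm (z - c) \<le> r + h}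
      \<union> {z \<in> cball (0 :: complex) (s + h). s \<le> norm (z - 0) \<and> norm (z - 0) \<le> s + h}"
    by (auto simp: transition_def)
  then have "emeasure lborel transition \<le> emeasure lborel ({z \<in> cball 0 (s + h). r \<le> norm (z - c) \<and> norm (z - c) \<le> r + h}
      \<union> {z \<in> cball (0 :: complex) (s + h). s \<le> norm (z - 0) \<and> norm (z - 0) \<le> s + h})"
    by (rule emeasure_mono) simp
  also have "\<dots> \<le> emeasure lborel {z \<in> cball 0 (s + h). r \<le> norm (z - c) \<and> norm (z - c) \<le> r + h}
      + emeasure lborel {z \<in> cball (0 :: complex) (s + h). s \<le> norm (z - 0) \<and> norm (z - 0) \<le> s + h}"
    by (rule emeasure_subadditive) auto
  also have "\<dots> \<le> ennreal (16 * (s + h) * h) + ennreal (16 * (s + h) * h)"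
    by (intro add_mono emeasure_annulus_Int_cball A.r B.r A.h sh)
  also have "\<dots> = ennreal (32 * (s + h) * h)"
    using sh by (simp flip: ennreal_plus)
  finally show ?thesis .
qed

end

section \<open>Finiteness of logarithmic potentials\<close>

lemma ext_log_measurable [measurable]: "ext_log \<in> borel_measurable borel"
  unfolding ext_log_def[abs_def] by measurable

lemma log_potential_measurable:
  assumes M: "prob_space M" and sets [measurable_cong]: "sets M = sets borel"
  shows "log_potential M \<in> borel_measurable borel"
proof -
  interpret prob_space M by fact
  have "(\<lambda>z. \<integral>\<^sup>+t. e2ennreal (ext_log (norm (t - z))) \<partial>M) \<in> borel_measurable borel"
    "(\<lambda>z. \<integral>\<^sup>+t. e2ennreal (- ext_log (norm (t - z))) \<partial>M) \<in> borel_measurable borel"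
    by measurable
  then show ?thesis
    unfolding log_potential_def[abs_def] ext_integral_def by measurable
qed

text \<open>
  If the extended integral is finite then so are both of its parts. In particular \<open>z\<close> is not an atom
  of \<open>M\<close>, so the convention \<open>ln 0 = 0\<close> affects only a null set.
\<close>
lemma log_potential_finiteD:
  assumes M: "prob_space M" and sets [measurable_cong]: "sets M = sets borel"
    and fin: "\<bar>log_potential M z\<bar> \<noteq> \<infinity>"
  shows "integrable M (\<lambda>t. ln (norm (t - z)))"
    and "log_potential M z = ereal (- (\<integral>t. ln (norm (t - z)) \<partial>M))"
proof -
  interpret prob_space M by fact
  define P where "P = (\<integral>\<^sup>+t. e2ennreal (ext_log (norm (t - z))) \<partial>M)"
  define N where "N = (\<integral>\<^sup>+t. e2ennreal (- ext_log (norm (t - z))) \<partial>M)"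
  have U: "log_potential M z = - (enn2ereal P - enn2ereal N)"
    by (simp add: log_potential_def ext_integral_def P_def N_def)
  have PN: "P \<noteq> \<infinity>" "N \<noteq> \<infinity>"
    using fin unfolding U by (cases P; cases N; simp add: enn2ereal_ennreal)+
  have "AE t in M. e2ennreal (- ext_log (norm (t - z))) \<noteq> \<infinity>"
    by (rule nn_integral_PInf_AE) (use PN in \<open>auto simp: N_def\<close>)
  then have ne: "AE t in M. t \<noteq> z"
    by eventually_elim (auto simp: ext_log_def)
  have P: "P = (\<integral>\<^sup>+t. ennreal (ln (norm (t - z))) \<partial>M)"
    unfolding P_def by (rule nn_integral_cong_AE, use ne in eventually_elim) (simp add: ext_log_def)
  have N: "N = (\<integral>\<^sup>+t. ennreal (- ln (norm (t - z))) \<partial>M)"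
    unfolding N_def by (rule nn_integral_cong_AE, use ne in eventually_elim) (simp add: ext_log_def)
  show int: "integrable M (\<lambda>t. ln (norm (t - z)))"
    using PN unfolding real_integrable_def P N by auto
  show "log_potential M z = ereal (- (\<integral>t. ln (norm (t - z)) \<partial>M))"
    unfolding U real_lebesgue_integral_def[OF int] P[symmetric] N[symmetric]
    using PN by (cases P; cases N) (auto simp: enn2ereal_ennreal)
qed

text \<open>
  A potential that is finite at a single point forces a finite logarithmic moment, since
  \<open>1 + norm t \<le> (1 + norm z) * (1 + norm (t - z))\<close>.
\<close>
lemma integrable_ln_tail:
  assumes M: "prob_space M" and sets [measurable_cong]: "sets M = sets borel"
    and int: "integrable M (\<lambda>t. ln (norm (t - z)))"
  shows "integrable M (\<lambda>t::complex. ln (1 + norm t))"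
proof -
  interpret prob_space M by fact
  show ?thesis
  proof (rule Bochner_Integration.integrable_bound)
    show "integrable M (\<lambda>t. \<bar>ln (norm (t - z))\<bar> + (ln (1 + norm z) + ln 2))"
      using int by (intro Bochner_Integration.integrable_add integrable_abs) auto
    show "AE t in M. norm (ln (1 + norm t)) \<le> norm (\<bar>ln (norm (t - z))\<bar> + (ln (1 + norm z) + ln 2))"
    proof (rule AE_I2)
      fix t :: complex
      have pos: "1 + norm z > 0" "1 + norm t > 0" by (auto intro: add_pos_nonneg)
      have "1 + norm t \<le> (1 + norm z) * (1 + norm (t - z))"
        using norm_triangle_ineq2[of t z] mult_nonneg_nonneg[OF norm_ge_zero[of z] norm_ge_zero[of "t - z"]]
        unfolding distrib_left distrib_right by linarith
      also have "\<dots> \<le> (1 + norm z) * (2 * max 1 (norm (t - z)))"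
        using pos by (intro mult_left_mono) auto
      finally have "ln (1 + norm t) \<le> ln ((1 + norm z) * (2 * max 1 (norm (t - z))))"
        using pos by (subst ln_le_cancel_iff) (auto intro!: mult_pos_pos)
      also have "\<dots> = ln (1 + norm z) + (ln 2 + ln (max 1 (norm (t - z))))"
        using pos by (simp add: ln_mult_pos)
      also have "ln (max 1 (norm (t - z))) \<le> \<bar>ln (norm (t - z))\<bar>"
        by (auto simp: max_def)
      finally show "norm (ln (1 + norm t)) \<le> norm (\<bar>ln (norm (t - z))\<bar> + (ln (1 + norm z) + ln 2))"
        by simp
    qed
  qed measurable
qed

section \<open>From \<open>L\<^sup>1\<close> to \<open>L\<^sup>p\<close>\<close>

lemma ennreal_powr_measurable [measurable]: "(\<lambda>x. ennreal_powr x q) \<in> borel_measurable borel"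
  unfolding ennreal_powr_def[abs_def] by measurable

text \<open>
  A rescaling of \<open>x \<le> 1 + x powr q\<close>. With a balancing choice of \<open>s\<close> it replaces Hoelder's inequality at the
  cost of a factor \<open>2\<close>.
\<close>
lemma young_ennreal:
  assumes s: "s > 0" and q: "q \<ge> 1"
  shows "x \<le> ennreal s + ennreal (s powr (1 - q)) * ennreal_powr x q"
proof (cases x)
  case (real r)
  have "r \<le> s + s powr (1 - q) * r powr q"
  proof (cases "r \<le> s")
    case False
    then have "1 \<le> (r / s) powr (q - 1)"
      using s q by (intro ge_one_powr_ge_zero) auto
    then have "r * 1 \<le> r * (r / s) powr (q - 1)"
      using False s by (intro mult_left_mono) auto
    also have "\<dots> = s powr (1 - q) * r powr q"
      using False s by (simp add: powr_divide powr_diff field_simps)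
    finally show ?thesis using s by simp
  qed (use s in \<open>simp add: add_increasing2\<close>)
  then show ?thesis
    using real s by (simp add: ennreal_powr_def ennreal_leI flip: ennreal_mult ennreal_plus)
next
  case top
  then show ?thesis using s by (simp add: ennreal_powr_def ennreal_mult_top)
qed

lemma enn2real_one_div:
  assumes "p \<noteq> \<infinity>" "1 \<le> p"
  shows "enn2real (1 / p) = 1 / enn2real p" "1 \<le> enn2real p"
proof -
  obtain r where r: "p = ennreal r" "r \<ge> 0" using assms by (cases p) auto
  then have "r \<ge> 1" using assms(2) by (simp add: ennreal_le_iff flip: ennreal_1)
  then show "1 \<le> enn2real p" "enn2real (1 / p) = 1 / enn2real p"
    using r by (simp_all add: divide_ennreal flip: ennreal_1)
qed

text \<open>
  Hoelder's inequality against the constant function on \<open>A\<close>, up to the factor \<open>2\<close>. For finite \<open>p\<close> and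
  norm \<open>n > 0\<close>, the two terms of Young's inequality balance at \<open>s = n * V powr (- 1 / p)\<close>.
\<close>
lemma nn_integral_le_Lp_norm:
  fixes F :: "'a::euclidean_space \<Rightarrow> ereal"
  assumes [measurable]: "F \<in> borel_measurable borel" "A \<in> sets borel" "S \<in> sets borel"
    and AS: "A \<subseteq> S" and V: "emeasure lborel A \<le> ennreal V" "V > 0" and p: "1 \<le> p"
  shows "(\<integral>\<^sup>+z\<in>A. e2ennreal \<bar>F z\<bar> \<partial>lborel)
    \<le> ennreal (2 * V powr (1 - enn2real (1 / p))) * Lp_norm_on p S F"
proof (cases "p = \<infinity>")
  case True
  have "AE z in restrict_space lborel S. e2ennreal \<bar>F z\<bar> \<le> Lp_norm_on p S F"
    using esssup_AE[where M = "restrict_space lborel S" and f = "\<lambda>z. e2ennreal \<bar>F z\<bar>"] True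
    by (simp add: Lp_norm_on_def)
  then have AE: "AE z in lborel. z \<in> S \<longrightarrow> e2ennreal \<bar>F z\<bar> \<le> Lp_norm_on p S F"
    by (subst (asm) AE_restrict_space_iff) auto
  have "(\<integral>\<^sup>+z\<in>A. e2ennreal \<bar>F z\<bar> \<partial>lborel) \<le> (\<integral>\<^sup>+z. Lp_norm_on p S F * indicator A z \<partial>lborel)"
    using AE AS by (intro nn_integral_mono_AE) (auto simp: indicator_def elim!: eventually_mono)
  also have "\<dots> = emeasure lborel A * Lp_norm_on p S F"
    by (subst nn_integral_cmult_indicator) (simp_all add: mult.commute)
  also have "\<dots> \<le> ennreal (2 * V) * Lp_norm_on p S F"
    using V by (intro mult_right_mono order_trans[OF V(1)] ennreal_leI) auto
  also have "2 * V = 2 * V powr (1 - enn2real (1 / p))"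
    using True V by (simp add: powr_one)
  finally show ?thesis .
next
  case False
  define q where "q = enn2real p"
  have q: "q \<ge> 1" "enn2real (1 / p) = 1 / q"
    using enn2real_one_div[OF False p] by (auto simp: q_def)
  define J where "J = (\<integral>\<^sup>+z\<in>S. ennreal_powr (e2ennreal \<bar>F z\<bar>) q \<partial>lborel)"
  have Lp: "Lp_norm_on p S F = ennreal_powr J (1 / q)"
    using False by (simp add: Lp_norm_on_def J_def q_def)
  show ?thesis
  proof (cases J)
    case top
    then show ?thesis using V(2) by (simp add: Lp ennreal_powr_def ennreal_mult_top)
  next
    case (real j)
    have young: "(\<integral>\<^sup>+z\<in>A. e2ennreal \<bar>F z\<bar> \<partial>lborel) \<le> ennreal (s * V + s powr (1 - q) * j)" if s: "s > 0" for s
    proof -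
      have "(\<integral>\<^sup>+z\<in>A. e2ennreal \<bar>F z\<bar> \<partial>lborel)
          \<le> (\<integral>\<^sup>+z. ennreal s * indicator A z
              + ennreal (s powr (1 - q)) * (ennreal_powr (e2ennreal \<bar>F z\<bar>) q * indicator S z) \<partial>lborel)"
        using AS young_ennreal[OF s q(1)] by (intro nn_integral_mono) (auto simp: indicator_def)
      also have "\<dots> = ennreal s * emeasure lborel A + ennreal (s powr (1 - q)) * J"
        unfolding J_def by (simp add: nn_integral_add nn_integral_cmult nn_integral_cmult_indicator)
      also have "\<dots> \<le> ennreal s * ennreal V + ennreal (s powr (1 - q)) * ennreal j"
        using real by (intro add_mono mult_left_mono V) auto
      also have "\<dots> = ennreal (s * V + s powr (1 - q) * j)"
        using s V real by (simp flip: ennreal_mult)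
      finally show ?thesis .
    qed
    show ?thesis
    proof (cases "j = 0")
      case True
      \<comment> \<open>for a vanishing norm the second term is absent and \<open>s\<close> may be taken arbitrarily small\<close>
      have "(\<integral>\<^sup>+z\<in>A. e2ennreal \<bar>F z\<bar> \<partial>lborel) \<le> 0"
      proof (rule ennreal_le_epsilon)
        fix e :: real assume e: "0 < e"
        show "(\<integral>\<^sup>+z\<in>A. e2ennreal \<bar>F z\<bar> \<partial>lborel) \<le> 0 + ennreal e"
          using young[of "e / V"] e V True by simp
      qed
      then show ?thesis by simp
    next
      case False
      then have j: "j > 0" using real by simp
      define n where "n = j powr (1 / q)"
      have n: "n > 0" "j = n powr q" "Lp_norm_on p S F = ennreal n"
        using j q real unfolding n_def Lp by (auto simp: powr_powr ennreal_powr_def)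
      define s where "s = n * V powr (- 1 / q)"
      have s: "s > 0" using n V by (simp add: s_def)
      have "s * V = n * V powr (1 - 1 / q)"
        using V by (simp add: s_def powr_diff powr_minus field_simps)
      moreover have "s powr (1 - q) * j = n * V powr (1 - 1 / q)"
      proof -
        have "s powr (1 - q) * j = (n powr (1 - q) * n powr q) * V powr ((- 1 / q) * (1 - q))"
          using n V by (simp add: s_def powr_mult powr_powr)
        also have "n powr (1 - q) * n powr q = n"
          using n by (simp add: powr_add[symmetric])
        also have "(- 1 / q) * (1 - q) = 1 - 1 / q" using q by (simp add: field_simps)
        finally show ?thesis .
      qed
      ultimately have "(\<integral>\<^sup>+z\<in>A. e2ennreal \<bar>F z\<bar> \<partial>lborel) \<le> ennreal (2 * V powr (1 - 1 / q) * n)"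
        using young[OF s] by (simp add: mult_ac)
      also have "\<dots> = ennreal (2 * V powr (1 - 1 / q)) * ennreal n"
        using n by (simp add: ennreal_mult)
      finally show ?thesis by (simp add: n q)
    qed
  qed
qed

text \<open>
  This is what excludes the degenerate measures: if the logarithmic moment of \<open>\<mu>\<close> is infinite, its
  potential is \<open>- \<infinity>\<close> almost everywhere and the norm of the difference is infinite.
\<close>
lemma AE_finite_of_Lp_norm:
  fixes F :: "'a::euclidean_space \<Rightarrow> ereal"
  assumes [measurable]: "F \<in> borel_measurable borel" "S \<in> sets borel"
    and S: "emeasure lborel S < \<infinity>" and p: "1 \<le> p" and fin: "Lp_norm_on p S F < \<infinity>"
  shows "AE z in lborel. z \<in> S \<longrightarrow> \<bar>F z\<bar> \<noteq> \<infinity>"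
proof -
  obtain v where v: "emeasure lborel S = ennreal v" "v \<ge> 0"
    using S by (cases "emeasure lborel S") auto
  have "(\<integral>\<^sup>+z\<in>S. e2ennreal \<bar>F z\<bar> \<partial>lborel)
      \<le> ennreal (2 * (v + 1) powr (1 - enn2real (1 / p))) * Lp_norm_on p S F"
    using v p by (intro nn_integral_le_Lp_norm) (auto intro!: ennreal_leI)
  also have "\<dots> < \<infinity>" using fin by (simp add: ennreal_mult_less_top)
  finally have "AE z in lborel. e2ennreal \<bar>F z\<bar> * indicator S z \<noteq> \<infinity>"
    by (intro nn_integral_PInf_AE) (auto simp: less_top)
  then show ?thesis
    by eventually_elim (auto simp: indicator_def)
qed

section \<open>Test functions integrated against the two measures\<close>

context C2_compact_support
begin

text \<open>
  Integrate the representation of \<open>f\<close> by its Laplacian against \<open>M\<close> and exchange the integrals. The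
  logarithmic moment of \<open>M\<close> makes the double integral absolutely convergent.
\<close>
lemma integral_via_logarithm:
  assumes M: "prob_space M" and sets [measurable_cong]: "sets M = sets borel"
    and tail: "integrable M (\<lambda>t. ln (1 + norm t))"
  shows "integrable lborel (\<lambda>z. (fxx z + fyy z) * (\<integral>t. ln (norm (t - z)) \<partial>M))"
    and "newton_const * (\<integral>t. f t \<partial>M)
      = (\<integral>z. (fxx z + fyy z) * (\<integral>t. ln (norm (t - z)) \<partial>M) \<partial>lborel)"
proof -
  interpret M: prob_space M by fact
  interpret pair_sigma_finite M "lborel :: complex measure" ..
  obtain G where G: "G \<ge> 0" "\<And>z. \<bar>fxx z + fyy z\<bar> \<le> G * indicator (cball 0 L) z"
    by (rule bounded_of_continuous_vanishing[of "\<lambda>z. fxx z + fyy z"])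
       (use vanish in \<open>auto intro!: continuous_intros cont_fxx cont_fyy\<close>)
  let ?k = "\<lambda>t z. (fxx z + fyy z) * ln (norm (t - z))"
  have int: "integrable (M \<Otimes>\<^sub>M lborel) (\<lambda>(t, z). ?k t z)"
  proof (rule integrableI_bounded)
    show "(\<lambda>(t, z). ?k t z) \<in> borel_measurable (M \<Otimes>\<^sub>M lborel)" by measurable
    have "(\<integral>\<^sup>+p. ennreal (norm (case p of (t, z) \<Rightarrow> ?k t z)) \<partial>(M \<Otimes>\<^sub>M lborel))
        = (\<integral>\<^sup>+t. \<integral>\<^sup>+z. ennreal \<bar>?k t z\<bar> \<partial>lborel \<partial>M)"
      by (subst lborel.nn_integral_fst[symmetric]) auto
    also have "\<dots> \<le> (\<integral>\<^sup>+t. ennreal G * (log_mass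
        + ennreal (ln (1 + L) + ln (1 + norm t)) * emeasure lborel (cball 0 L :: complex set)) \<partial>M)"
    proof (rule nn_integral_mono)
      fix t
      have "(\<integral>\<^sup>+z. ennreal \<bar>?k t z\<bar> \<partial>lborel)
          \<le> (\<integral>\<^sup>+z. ennreal G * (ennreal \<bar>ln (norm (t - z))\<bar> * indicator (cball 0 L) z) \<partial>lborel)"
      proof (rule nn_integral_mono)
        fix z
        have "\<bar>?k t z\<bar> \<le> G * indicator (cball 0 L) z * \<bar>ln (norm (t - z))\<bar>"
          unfolding abs_mult by (intro mult_right_mono G) simp
        then have "ennreal \<bar>?k t z\<bar> \<le> ennreal (G * indicator (cball 0 L) z * \<bar>ln (norm (t - z))\<bar>)"
          by (rule ennreal_leI)
        also have "\<dots> = ennreal G * (ennreal \<bar>ln (norm (t - z))\<bar> * indicator (cball 0 L) z)"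
          using G(1) by (cases "z \<in> cball 0 L") (simp_all add: ennreal_mult)
        finally show "ennreal \<bar>?k t z\<bar>
            \<le> ennreal G * (ennreal \<bar>ln (norm (t - z))\<bar> * indicator (cball 0 L) z)" .
      qed
      also have "\<dots> = ennreal G * (\<integral>\<^sup>+z. ennreal \<bar>ln (norm (t - z))\<bar> * indicator (cball 0 L) z \<partial>lborel)"
        by (rule nn_integral_cmult) (auto intro!: borel_measurable_times_ennreal borel_measurable_indicator)
      also have "\<dots> \<le> ennreal G * (log_mass
          + ennreal (ln (1 + L) + ln (1 + norm t)) * emeasure lborel (cball 0 L :: complex set))"
        by (intro mult_left_mono nn_integral_abs_ln_cball L_pos) simp
      finally show "(\<integral>\<^sup>+z. ennreal \<bar>?k t z\<bar> \<partial>lborel) \<le> \<dots>" .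
    qed
    also have "\<dots> = ennreal G * (log_mass
        + (\<integral>\<^sup>+t. ennreal (ln (1 + L) + ln (1 + norm t)) \<partial>M) * emeasure lborel (cball 0 L :: complex set))"
      by (simp add: nn_integral_cmult nn_integral_add nn_integral_multc M.emeasure_space_1)
    also have "\<dots> < \<infinity>"
    proof -
      have "integrable M (\<lambda>t. ln (1 + L) + ln (1 + norm t))"
        using tail by (intro Bochner_Integration.integrable_add) auto
      then have "(\<integral>\<^sup>+t. ennreal (norm (ln (1 + L) + ln (1 + norm t))) \<partial>M) < \<infinity>"
        by (simp add: integrable_iff_bounded)
      moreover have "norm (ln (1 + L) + ln (1 + norm t)) = ln (1 + L) + ln (1 + norm t)" for t :: complex
        using L_pos by simp
      ultimately show ?thesis
        using log_mass_finite emeasure_lborel_cball_finite[of "0::complex" L]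
        by (simp add: ennreal_mult_less_top)
    qed
    finally show "(\<integral>\<^sup>+p. ennreal (norm (case p of (t, z) \<Rightarrow> ?k t z)) \<partial>(M \<Otimes>\<^sub>M lborel)) < \<infinity>" .
  qed
  have inner: "(\<integral>t. ?k t z \<partial>M) = (fxx z + fyy z) * (\<integral>t. ln (norm (t - z)) \<partial>M)" for z
    by simp
  show "integrable lborel (\<lambda>z. (fxx z + fyy z) * (\<integral>t. ln (norm (t - z)) \<partial>M))"
    using integrable_snd[OF int] unfolding inner .
  have "newton_const * (\<integral>t. f t \<partial>M) = (\<integral>t. \<integral>z. ?k t z \<partial>lborel \<partial>M)"
    unfolding newtonian_potential by simp
  also have "\<dots> = (\<integral>z. \<integral>t. ?k t z \<partial>M \<partial>lborel)"
    by (rule Fubini_integral[symmetric]) (rule int)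
  finally show "newton_const * (\<integral>t. f t \<partial>M)
      = (\<integral>z. (fxx z + fyy z) * (\<integral>t. ln (norm (t - z)) \<partial>M) \<partial>lborel)"
    unfolding inner .
qed

text \<open>
  A finite difference of potentials at one point of \<open>S\<close> means that both potentials are finite there, so
  both measures have a logarithmic moment. The representation of \<open>f\<close> by its Laplacian then turns
  the difference of the integrals of \<open>f\<close> into an integral of the Laplacian against the difference of
  the potentials.
\<close>
lemma integral_difference_le:
  assumes \<mu>: "prob_space \<mu>" "sets \<mu> = sets borel" and \<nu>: "prob_space \<nu>" "sets \<nu> = sets borel"
    and S: "S \<in> sets borel" "emeasure lborel S \<noteq> 0"
    and fin: "AE z in lborel. z \<in> S \<longrightarrow> \<bar>log_potential \<mu> z - log_potential \<nu> z\<bar> \<noteq> \<infinity>"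
    and A [measurable]: "A \<in> sets borel" and AS: "A \<subseteq> S"
    and G: "G \<ge> 0" "\<And>z. \<bar>fxx z + fyy z\<bar> \<le> G * indicator A z"
  shows "ennreal \<bar>(\<integral>t. f t \<partial>\<mu>) - (\<integral>t. f t \<partial>\<nu>)\<bar>
    \<le> ennreal (G / newton_const) * (\<integral>\<^sup>+z\<in>A. e2ennreal \<bar>log_potential \<mu> z - log_potential \<nu> z\<bar> \<partial>lborel)"
proof -
  have [measurable]: "log_potential \<mu> \<in> borel_measurable borel" "log_potential \<nu> \<in> borel_measurable borel"
    using log_potential_measurable \<mu> \<nu> by auto
  have finite_parts: "\<bar>x\<bar> \<noteq> \<infinity> \<and> \<bar>y\<bar> \<noteq> \<infinity>" if "\<bar>x - y\<bar> \<noteq> \<infinity>" for x y :: ereal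
    using that by (cases x; cases y) auto
  have "\<exists>z\<in>S. \<bar>log_potential \<mu> z - log_potential \<nu> z\<bar> \<noteq> \<infinity>"
  proof (rule ccontr)
    assume "\<not> ?thesis"
    then have "AE z in lborel. z \<notin> S" using fin by (auto elim!: eventually_mono)
    then show False using S by (simp add: AE_iff_measurable[OF _ refl] Collect_mem_eq)
  qed
  then obtain z1 where z1: "\<bar>log_potential \<mu> z1 - log_potential \<nu> z1\<bar> \<noteq> \<infinity>"
    by (elim bexE)
  then have z1\<mu>: "\<bar>log_potential \<mu> z1\<bar> \<noteq> \<infinity>" and z1\<nu>: "\<bar>log_potential \<nu> z1\<bar> \<noteq> \<infinity>"
    using finite_parts[OF z1] by auto
  note tails = integrable_ln_tail[OF \<mu> log_potential_finiteD(1)[OF \<mu> z1\<mu>]]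
    integrable_ln_tail[OF \<nu> log_potential_finiteD(1)[OF \<nu> z1\<nu>]]
  define u where "u z = (\<integral>t. ln (norm (t - z)) \<partial>\<mu>)" for z
  define v where "v z = (\<integral>t. ln (norm (t - z)) \<partial>\<nu>)" for z
  note iu = integral_via_logarithm[OF \<mu> tails(1), folded u_def]
  note iv = integral_via_logarithm[OF \<nu> tails(2), folded v_def]
  have c: "newton_const > 0" by (rule newton_const_pos)
  have "newton_const * ((\<integral>t. f t \<partial>\<mu>) - (\<integral>t. f t \<partial>\<nu>))
      = (\<integral>z. (fxx z + fyy z) * u z - (fxx z + fyy z) * v z \<partial>lborel)"
    using iu iv by (simp add: right_diff_distrib)
  then have "ennreal (newton_const * \<bar>(\<integral>t. f t \<partial>\<mu>) - (\<integral>t. f t \<partial>\<nu>)\<bar>)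
      = ennreal (norm (\<integral>z. (fxx z + fyy z) * u z - (fxx z + fyy z) * v z \<partial>lborel))"
    using c by (metis abs_mult abs_of_pos real_norm_def)
  also have "\<dots> \<le> (\<integral>\<^sup>+z. ennreal (norm ((fxx z + fyy z) * u z - (fxx z + fyy z) * v z)) \<partial>lborel)"
    using iu iv by (intro integral_norm_bound_ennreal Bochner_Integration.integrable_diff) auto
  also have "\<dots> \<le> (\<integral>\<^sup>+z. ennreal G * (e2ennreal \<bar>log_potential \<mu> z - log_potential \<nu> z\<bar> * indicator A z) \<partial>lborel)"
  proof (rule nn_integral_mono_AE, use fin in eventually_elim)
    case (elim z)
    have eq: "norm ((fxx z + fyy z) * u z - (fxx z + fyy z) * v z) = \<bar>fxx z + fyy z\<bar> * \<bar>u z - v z\<bar>"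
      by (simp only: right_diff_distrib[symmetric] abs_mult real_norm_def)
    show ?case
    proof (cases "z \<in> A")
      case True
      then have z: "\<bar>log_potential \<mu> z - log_potential \<nu> z\<bar> \<noteq> \<infinity>"
        using elim AS by auto
      have z\<mu>: "\<bar>log_potential \<mu> z\<bar> \<noteq> \<infinity>" and z\<nu>: "\<bar>log_potential \<nu> z\<bar> \<noteq> \<infinity>"
        using finite_parts[OF z] by auto
      have "log_potential \<mu> z - log_potential \<nu> z = ereal (v z - u z)"
        using log_potential_finiteD(2)[OF \<mu> z\<mu>] log_potential_finiteD(2)[OF \<nu> z\<nu>]
        by (simp add: u_def v_def)
      moreover have "\<bar>fxx z + fyy z\<bar> * \<bar>u z - v z\<bar> \<le> G * \<bar>u z - v z\<bar>"
        using G(2)[of z] True by (intro mult_right_mono) auto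
      ultimately show ?thesis
        using True G(1) unfolding eq
        by (simp add: ennreal_mult[symmetric] abs_minus_commute ennreal_leI)
    next
      case False
      then show ?thesis using G(2)[of z] unfolding eq by simp
    qed
  qed
  also have "\<dots> = ennreal G * (\<integral>\<^sup>+z\<in>A. e2ennreal \<bar>log_potential \<mu> z - log_potential \<nu> z\<bar> \<partial>lborel)"
    by (rule nn_integral_cmult) measurable
  finally have *: "ennreal (newton_const * \<bar>(\<integral>t. f t \<partial>\<mu>) - (\<integral>t. f t \<partial>\<nu>)\<bar>)
      \<le> ennreal G * (\<integral>\<^sup>+z\<in>A. e2ennreal \<bar>log_potential \<mu> z - log_potential \<nu> z\<bar> \<partial>lborel)" .
  have "ennreal \<bar>(\<integral>t. f t \<partial>\<mu>) - (\<integral>t. f t \<partial>\<nu>)\<bar>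
      = ennreal (1 / newton_const) * ennreal (newton_const * \<bar>(\<integral>t. f t \<partial>\<mu>) - (\<integral>t. f t \<partial>\<nu>)\<bar>)"
    using c by (simp flip: ennreal_mult)
  also have "\<dots> \<le> ennreal (1 / newton_const) * (ennreal G * (\<integral>\<^sup>+z\<in>A. e2ennreal \<bar>log_potential \<mu> z - log_potential \<nu> z\<bar> \<partial>lborel))"
    by (intro mult_left_mono *) simp
  also have "\<dots> = ennreal (G / newton_const) * (\<integral>\<^sup>+z\<in>A. e2ennreal \<bar>log_potential \<mu> z - log_potential \<nu> z\<bar> \<partial>lborel)"
    using c G(1) by (simp add: mult.assoc[symmetric] flip: ennreal_mult)
  finally show ?thesis .
qed

end

context disc_pair_cutoff
begin

lemma test_sandwich:
  assumes M: "prob_space M" and sets [measurable_cong]: "sets M = sets borel"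
  shows "measure M (cball c r \<inter> cball 0 s) \<le> (\<integral>t. test t \<partial>M)"
    and "(\<integral>t. test t \<partial>M) \<le> measure M (ball c (r + h) \<inter> ball 0 (s + h))"
proof -
  interpret prob_space M by fact
  have int: "integrable M test"
    by (rule integrable_const_bound[where B = 1]) (use test_bounds in auto)
  have "measure M (cball c r \<inter> cball 0 s) = (\<integral>t. indicator (cball c r \<inter> cball 0 s) t \<partial>M)"
    by simp
  also have "\<dots> \<le> (\<integral>t. test t \<partial>M)"
    by (intro integral_mono int integrable_real_indicator)
       (auto simp: indicator_def test_bounds test_eq_1 dist_norm norm_minus_commute emeasure_eq_measure)
  finally show "measure M (cball c r \<inter> cball 0 s) \<le> (\<integral>t. test t \<partial>M)" .
  have "(\<integral>t. test t \<partial>M) \<le> (\<integral>t. indicator (ball c (r + h) \<inter> ball 0 (s + h)) t \<partial>M)"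
  proof (intro integral_mono int integrable_real_indicator)
    fix t
    show "test t \<le> indicator (ball c (r + h) \<inter> ball 0 (s + h)) t"
    proof (cases "t \<in> ball c (r + h) \<inter> ball 0 (s + h)")
      case False
      then have "norm (t - c) \<ge> r + h \<or> norm t \<ge> s + h"
        by (auto simp: dist_norm norm_minus_commute)
      then show ?thesis by (simp add: test_eq_0)
    qed (simp add: test_bounds)
  qed (auto simp: emeasure_eq_measure)
  also have "\<dots> = measure M (ball c (r + h) \<inter> ball 0 (s + h))"
    by simp
  finally show "(\<integral>t. test t \<partial>M) \<le> measure M (ball c (r + h) \<inter> ball 0 (s + h))" .
qed

text \<open>
  The exponent of \<open>1 / h\<close> is the balance of the size \<open>1 / h\<^sup>2\<close> of the Laplacian and the area
  of order \<open>h\<close> of its support, the latter raised to \<open>1 - 1 / p\<close>. Since \<open>s \<le> K\<close>, that support lies in the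
  disc of radius \<open>K + h\<close>; \<open>h \<le> 2\<close> bounds this radius by \<open>K + 2\<close>.
\<close>
lemma test_discrepancy:
  assumes \<mu>: "prob_space \<mu>" "sets \<mu> = sets borel" and \<nu>: "prob_space \<nu>" "sets \<nu> = sets borel"
    and sK: "s \<le> K" and h2: "h \<le> 2" and p: "1 \<le> p"
    and fin: "Lp_norm_on p (ball 0 (K + h)) (\<lambda>z. log_potential \<mu> z - log_potential \<nu> z) < \<infinity>"
  shows "ennreal \<bar>(\<integral>t. test t \<partial>\<mu>) - (\<integral>t. test t \<partial>\<nu>)\<bar>
    \<le> ennreal (31200 / newton_const * (32 * (K + 2)) * (1 / h) powr (1 + enn2real (1 / p)))
       * Lp_norm_on p (ball 0 (K + h)) (\<lambda>z. log_potential \<mu> z - log_potential \<nu> z)"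
proof -
  let ?F = "\<lambda>z. log_potential \<mu> z - log_potential \<nu> z"
  let ?S = "ball 0 (K + h) :: complex set"
  define x where "x = enn2real (1 / p)"
  define V where "V = 32 * (K + 2) * h"
  have h: "h > 0" and K: "K \<ge> 0" using A.h B.r sK by auto
  have x: "0 \<le> x" "x \<le> 1"
  proof -
    show "0 \<le> x" by (simp add: x_def)
    show "x \<le> 1"
      using enn2real_one_div[of p] p unfolding x_def by (cases "p = \<infinity>") auto
  qed
  have [measurable]: "log_potential \<mu> \<in> borel_measurable borel" "log_potential \<nu> \<in> borel_measurable borel"
    using log_potential_measurable \<mu> \<nu> by auto
  have V: "V > 0" "emeasure lborel transition \<le> ennreal V"
  proof -
    show "V > 0" using h K by (simp add: V_def)
    have "32 * (s + h) * h \<le> V"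
      unfolding V_def using h sK h2 by (intro mult_right_mono mult_left_mono) auto
    then show "emeasure lborel transition \<le> ennreal V"
      using emeasure_transition ennreal_leI order_trans by blast
  qed
  have AS: "transition \<subseteq> ?S" using sK by (auto simp: transition_def)
  have "ennreal \<bar>(\<integral>t. test t \<partial>\<mu>) - (\<integral>t. test t \<partial>\<nu>)\<bar>
      \<le> ennreal (15600 / h\<^sup>2 / newton_const) * (\<integral>\<^sup>+z\<in>transition. e2ennreal \<bar>?F z\<bar> \<partial>lborel)"
  proof (rule integral_difference_le[OF \<mu> \<nu> _ _ _ transition_measurable AS _ laplacian_test_bound])
    show "emeasure lborel ?S \<noteq> 0"
    proof
      assume "emeasure lborel ?S = 0"
      then show False using content_ball_pos[of "K + h" "0 :: complex"] h K by (simp add: measure_def)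
    qed
    show "AE z in lborel. z \<in> ?S \<longrightarrow> \<bar>?F z\<bar> \<noteq> \<infinity>"
      using fin p by (intro AE_finite_of_Lp_norm emeasure_lborel_ball_finite) auto
  qed auto
  also have "\<dots> \<le> ennreal (15600 / h\<^sup>2 / newton_const) * (ennreal (2 * V powr (1 - x)) * Lp_norm_on p ?S ?F)"
    unfolding x_def using V p AS by (intro mult_left_mono nn_integral_le_Lp_norm) auto
  also have "\<dots> = ennreal (15600 / h\<^sup>2 / newton_const * (2 * V powr (1 - x))) * Lp_norm_on p ?S ?F"
    unfolding mult.assoc[symmetric] using newton_const_pos by (subst ennreal_mult [symmetric]) (auto simp: mult.assoc)
  also have "\<dots> \<le> ennreal (31200 / newton_const * (32 * (K + 2)) * (1 / h) powr (1 + x)) * Lp_norm_on p ?S ?F"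
  proof (intro mult_right_mono ennreal_leI)
    have "V powr (1 - x) = (32 * (K + 2)) powr (1 - x) * h powr (1 - x)"
      unfolding V_def using h K by (subst powr_mult) auto
    also have "\<dots> \<le> (32 * (K + 2)) powr 1 * h powr (1 - x)"
      using x K by (intro mult_right_mono powr_mono) auto
    finally have Vx: "V powr (1 - x) \<le> 32 * (K + 2) * h powr (1 - x)" using K by simp
    have "h powr (1 - x) / h\<^sup>2 = h powr (1 - x) / h powr 2"
      using h by (simp add: powr_numeral)
    also have "\<dots> = h powr (- (1 + x))"
      by (simp add: powr_diff[symmetric])
    also have "\<dots> = inverse (h powr (1 + x))"
      by (rule powr_minus)
    also have "\<dots> = (1 / h) powr (1 + x)"
      using h by (simp add: powr_divide inverse_eq_divide)
    finally have hx: "h powr (1 - x) / h\<^sup>2 = (1 / h) powr (1 + x)" .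
    have "15600 / h\<^sup>2 / newton_const * (2 * V powr (1 - x))
        \<le> 15600 / h\<^sup>2 / newton_const * (2 * (32 * (K + 2) * h powr (1 - x)))"
      using newton_const_pos by (intro mult_left_mono Vx) auto
    also have "\<dots> = 31200 / newton_const * (32 * (K + 2)) * (h powr (1 - x) / h\<^sup>2)"
      by (simp add: mult_ac divide_inverse)
    finally show "15600 / h\<^sup>2 / newton_const * (2 * V powr (1 - x))
        \<le> 31200 / newton_const * (32 * (K + 2)) * (1 / h) powr (1 + x)"
      unfolding hx .
  qed simp
  finally show ?thesis unfolding x_def .
qed

end

section \<open>Comparison of the measures of balls\<close>

text \<open>
  By second countability the complement of the support is a countable union of open null sets.
\<close>
lemma measure_ball_eq_1_of_support:
  fixes \<nu> :: "complex measure"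
  assumes \<nu>: "prob_space \<nu>" and sets [measurable_cong]: "sets \<nu> = sets borel"
    and supp: "measure_support \<nu> \<subseteq> ball 0 K"
  shows "measure \<nu> (ball 0 K) = 1"
proof -
  interpret prob_space \<nu> by fact
  obtain B :: "complex set set" where B: "countable B" "topological_basis B"
    using ex_countable_basis by blast
  define Z where "Z = \<Union> {b \<in> B. emeasure \<nu> b = 0}"
  have "open b" if "b \<in> B" for b using B(2) that by (rule topological_basis_open)
  then have Z: "Z \<in> null_sets \<nu>"
    unfolding Z_def using B(1) null_sets_UN'[of "{b \<in> B. emeasure \<nu> b = 0}" "\<lambda>b. b" \<nu>]
    by (auto simp: null_sets_def sets)
  have "- ball 0 K \<subseteq> Z"
  proof
    fix x :: complex assume "x \<in> - ball 0 K"
    then have "x \<notin> measure_support \<nu>" using supp by auto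
    then obtain U where U: "open U" "x \<in> U" "emeasure \<nu> U = 0"
      by (auto simp: measure_support_def zero_less_iff_neq_zero)
    then obtain b where b: "b \<in> B" "x \<in> b" "b \<subseteq> U"
      using B(2) by (meson topological_basisE)
    then have "emeasure \<nu> b \<le> emeasure \<nu> U" using U by (intro emeasure_mono) (auto simp: sets)
    then show "x \<in> Z" using U b by (auto simp: Z_def)
  qed
  then have "AE x in \<nu>. x \<in> ball 0 K"
    by (intro AE_I'[OF Z]) auto
  then show ?thesis by (subst prob_eq_1) (auto simp: sets)
qed

text \<open>
  Sandwich the ball between cutoffs at scale \<open>h\<close>. From below, a cutoff supported in the ball and equal
  to \<open>1\<close> on the ball shrunk by \<open>h\<close>, intersected with the disc of radius \<open>K\<close>, costs \<open>E + T\<close>; the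
  intersection is harmless because \<open>\<nu>\<close> lives in that disc. From above, the same comparison works only
  for the part of the ball in the disc of radius \<open>K\<close>. The mass of \<open>\<mu>\<close> outside that disc is
  controlled separately, by a test function supported in the disc itself: it shows that \<open>\<mu>\<close> has
  almost as much mass there as \<open>\<nu>\<close>, which has all of it. When \<open>R < h\<close> or \<open>K < h\<close> there is no room to
  shrink, but then the ball, respectively the disc, lies in a ball of radius \<open>h\<close>, which is an
  annulus of inner radius \<open>0\<close> and has \<open>\<nu>\<close>-mass at most \<open>T\<close>.
\<close>
lemma ball_discrepancy_le:
  fixes \<mu> \<nu> :: "complex measure"
  assumes \<mu>: "prob_space \<mu>" and sets\<mu> [measurable_cong]: "sets \<mu> = sets borel"
    and \<nu>: "prob_space \<nu>" and sets\<nu> [measurable_cong]: "sets \<nu> = sets borel"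
    and h: "h > 0" and K: "K > 0" and R: "R > 0"
    and test: "\<And>c r s. 0 \<le> r \<Longrightarrow> 0 \<le> s \<Longrightarrow> s \<le> K \<Longrightarrow>
      \<bar>(\<integral>t. disc_pair_cutoff.test c r s h t \<partial>\<mu>) - (\<integral>t. disc_pair_cutoff.test c r s h t \<partial>\<nu>)\<bar> \<le> E"
    and annulus: "\<And>r z0. 0 \<le> r \<Longrightarrow> measure \<nu> (closure (ball z0 (r + h) - ball z0 r)) \<le> T"
    and conc: "measure \<nu> (ball 0 K) = 1"
  shows "\<bar>measure \<mu> (ball z R) - measure \<nu> (ball z R)\<bar> \<le> 2 * (E + T)"
proof -
  interpret \<mu>: prob_space \<mu> by fact
  interpret \<nu>: prob_space \<nu> by fact
  have E: "E \<ge> 0" using test[of 0 0] K by (meson abs_ge_zero order_refl order_less_imp_le order_trans)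
  have T: "T \<ge> 0" using annulus[of 0] measure_nonneg order_trans by blast
  have cutoffs: "disc_pair_cutoff r s h" if "0 \<le> r" "0 \<le> s" for r s
    using that h by unfold_locales
  have step: "measure \<nu> (ball z0 (r + h)) \<le> measure \<nu> (ball z0 r) + T" if "0 \<le> r" for z0 r
  proof -
    have "measure \<nu> (ball z0 (r + h)) \<le> measure \<nu> (ball z0 r \<union> closure (ball z0 (r + h) - ball z0 r))"
      using closure_subset[of "ball z0 (r + h) - ball z0 r"]
      by (intro \<nu>.finite_measure_mono) (auto simp: sets\<nu>)
    also have "\<dots> \<le> measure \<nu> (ball z0 r) + measure \<nu> (closure (ball z0 (r + h) - ball z0 r))"
      by (intro measure_Un_le) (auto simp: sets\<nu>)
    finally show ?thesis using annulus[OF that, of z0] by linarith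
  qed
  have restrict: "measure M X \<le> measure M (X \<inter> ball 0 K) + (1 - measure M (ball 0 K))"
    if "prob_space M" "sets M = sets borel" "X \<in> sets borel" for M :: "complex measure" and X
  proof -
    interpret M: prob_space M by fact
    have [measurable]: "X \<in> sets M" "ball 0 K \<in> sets M" using that by auto
    have "measure M X \<le> measure M ((X \<inter> ball 0 K) \<union> (space M - ball 0 K))"
      using sets.sets_into_space[of X M] by (intro M.finite_measure_mono) auto
    also have "\<dots> \<le> measure M (X \<inter> ball 0 K) + measure M (space M - ball 0 K)"
      by (intro measure_Un_le) auto
    also have "measure M (space M - ball 0 K) = 1 - measure M (ball 0 K)"
      using that by (intro M.prob_compl) auto
    finally show ?thesis .
  qed
  have lower: "measure \<nu> (ball z R) \<le> measure \<mu> (ball z R) + E + T"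
  proof (cases "R < h")
    case True
    have "measure \<nu> (ball z R) \<le> measure \<nu> (ball z (0 + h))"
      using True by (intro \<nu>.finite_measure_mono) (auto simp: sets\<nu>)
    also have "\<dots> \<le> T" using step[of 0 z] by simp
    finally show ?thesis using E measure_nonneg[of \<mu> "ball z R"] by linarith
  next
    case False
    interpret disc_pair_cutoff z "R - h" K h using cutoffs False K by auto
    have "measure \<nu> (ball z R) \<le> measure \<nu> (ball z (R - h)) + T"
      using step[of "R - h" z] False by simp
    also have "measure \<nu> (ball z (R - h)) \<le> measure \<nu> (ball z (R - h) \<inter> ball 0 K)"
      using restrict[OF \<nu> sets\<nu>, of "ball z (R - h)"] conc by simp
    also have "\<dots> \<le> measure \<nu> (cball z (R - h) \<inter> cball 0 K)"
      by (intro \<nu>.finite_measure_mono) (auto simp: sets\<nu>)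
    also have "\<dots> \<le> (\<integral>t. test t \<partial>\<nu>)" by (rule test_sandwich[OF \<nu> sets\<nu>])
    also have "\<dots> \<le> (\<integral>t. test t \<partial>\<mu>) + E"
      using test[of "R - h" K z] False K by linarith
    also have "(\<integral>t. test t \<partial>\<mu>) \<le> measure \<mu> (ball z (R - h + h) \<inter> ball 0 (K + h))"
      by (rule test_sandwich[OF \<mu> sets\<mu>])
    also have "\<dots> \<le> measure \<mu> (ball z R)"
      by (intro \<mu>.finite_measure_mono) (auto simp: sets\<mu>)
    finally show ?thesis by simp
  qed
  have outside: "1 - measure \<mu> (ball 0 K) \<le> E + T"
  proof (cases "K < h")
    case True
    have "measure \<nu> (ball 0 K) \<le> measure \<nu> (ball 0 (0 + h))"
      using True by (intro \<nu>.finite_measure_mono) (auto simp: sets\<nu>)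
    also have "\<dots> \<le> T" using step[of 0 0] by simp
    finally show ?thesis using E conc measure_nonneg[of \<mu> "ball 0 K"] by linarith
  next
    case False
    interpret disc_pair_cutoff 0 "K - h" "K - h" h using cutoffs False by auto
    have "1 \<le> measure \<nu> (ball 0 (K - h)) + T"
      using step[of "K - h" 0] False conc by simp
    also have "measure \<nu> (ball 0 (K - h)) \<le> measure \<nu> (cball 0 (K - h) \<inter> cball 0 (K - h))"
      by (intro \<nu>.finite_measure_mono) (auto simp: sets\<nu>)
    also have "\<dots> \<le> (\<integral>t. test t \<partial>\<nu>)" by (rule test_sandwich[OF \<nu> sets\<nu>])
    also have "\<dots> \<le> (\<integral>t. test t \<partial>\<mu>) + E"
      using test[of "K - h" "K - h" 0] False h by linarith
    also have "(\<integral>t. test t \<partial>\<mu>) \<le> measure \<mu> (ball 0 (K - h + h) \<inter> ball 0 (K - h + h))"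
      by (rule test_sandwich[OF \<mu> sets\<mu>])
    finally show ?thesis by simp
  qed
  have upper: "measure \<mu> (ball z R) \<le> measure \<nu> (ball z R) + 2 * (E + T)"
  proof -
    interpret disc_pair_cutoff z R K h using cutoffs R K by auto
    have "measure \<mu> (ball z R) \<le> measure \<mu> (ball z R \<inter> ball 0 K) + (E + T)"
      using restrict[OF \<mu> sets\<mu>, of "ball z R"] outside by simp
    also have "measure \<mu> (ball z R \<inter> ball 0 K) \<le> measure \<mu> (cball z R \<inter> cball 0 K)"
      by (intro \<mu>.finite_measure_mono) (auto simp: sets\<mu>)
    also have "\<dots> \<le> (\<integral>t. test t \<partial>\<mu>)" by (rule test_sandwich[OF \<mu> sets\<mu>])
    also have "\<dots> \<le> (\<integral>t. test t \<partial>\<nu>) + E"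
      using test[of R K z] R K by linarith
    also have "(\<integral>t. test t \<partial>\<nu>) \<le> measure \<nu> (ball z (R + h) \<inter> ball 0 (K + h))"
      by (rule test_sandwich[OF \<nu> sets\<nu>])
    also have "\<dots> \<le> measure \<nu> (ball z (R + h))"
      by (intro \<nu>.finite_measure_mono) (auto simp: sets\<nu>)
    also have "\<dots> \<le> measure \<nu> (ball z R) + T" using step[of R z] R by simp
    finally show ?thesis by simp
  qed
  show ?thesis using lower upper E T by (simp add: abs_le_iff)
qed

theorem theorem5:
  fixes K :: real
  assumes "K > 0"
  shows "\<exists>c::real. c > 0 \<and>
    (\<forall>(\<mu>::complex measure) (\<nu>::complex measure) (p::ennreal) (a::real).
       prob_space \<mu> \<longrightarrow> sets \<mu> = sets borel \<longrightarrow>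
       prob_space \<nu> \<longrightarrow> sets \<nu> = sets borel \<longrightarrow>
       measure_support \<nu> \<subseteq> ball 0 K \<longrightarrow>
       1 \<le> p \<longrightarrow> a \<ge> 1 / 2 \<longrightarrow>
       ennreal (kolmogorov_ball_dist \<mu> \<nu>) \<le>
         ennreal c *
           (ennreal (a powr (1 + enn2real (1 / p))) *
              Lp_norm_on p (ball 0 (K + 1 / a)) (\<lambda>z. log_potential \<mu> z - log_potential \<nu> z)
            + ennreal (SUP (R, z0) \<in> {0..} \<times> UNIV.
                measure \<nu> (closure (ball z0 (R + 1 / a) - ball z0 R)))))"
proof -
  \<comment> \<open>\<open>31200\<close> is the constant of the Laplacian bound times the factor \<open>2\<close> lost in Hoelder's inequality; \<open>32 * (K + 2) * h\<close> bounds the area\<close>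
  define C where "C = 31200 / newton_const * (32 * (K + 2))"
  have C: "C > 0" using assms newton_const_pos by (simp add: C_def)
  show ?thesis
  proof (intro exI[of _ "2 * max C 1"] conjI allI impI)
    show "2 * max C 1 > 0" by simp
    fix \<mu> \<nu> :: "complex measure" and p :: ennreal and a :: real
    assume \<mu>: "prob_space \<mu>" "sets \<mu> = sets borel" and \<nu>: "prob_space \<nu>" "sets \<nu> = sets borel"
      and supp: "measure_support \<nu> \<subseteq> ball 0 K" and p: "1 \<le> p" and a: "a \<ge> 1 / 2"
    interpret \<mu>: prob_space \<mu> by fact
    interpret \<nu>: prob_space \<nu> by fact
    define h where "h = 1 / a"
    have h: "h > 0" "h \<le> 2" using a by (auto simp: h_def divide_simps)
    define N where "N = Lp_norm_on p (ball 0 (K + 1 / a)) (\<lambda>z. log_potential \<mu> z - log_potential \<nu> z)"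
    define T where "T = (SUP (R, z0) \<in> {0..} \<times> UNIV. measure \<nu> (closure (ball z0 (R + 1 / a) - ball z0 R)))"
    have annulus: "measure \<nu> (closure (ball z0 (r + h) - ball z0 r)) \<le> T" if "0 \<le> r" for r z0
    proof -
      have "bdd_above ((\<lambda>(R, z0). measure \<nu> (closure (ball z0 (R + 1 / a) - ball z0 R))) ` ({0..} \<times> UNIV))"
        by (intro bdd_aboveI[of _ 1]) auto
      then show ?thesis
        using cSUP_upper[of "(r, z0)" "{0..} \<times> UNIV" "\<lambda>(R, z0). measure \<nu> (closure (ball z0 (R + 1 / a) - ball z0 R))"] that
        by (simp add: T_def h_def)
    qed
    have T: "T \<ge> 0" using annulus[of 0] measure_nonneg order_trans by blast
    show "ennreal (kolmogorov_ball_dist \<mu> \<nu>) \<le> ennreal (2 * max C 1) *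
        (ennreal (a powr (1 + enn2real (1 / p))) * N + ennreal T)" (is "_ \<le> ?rhs")
      unfolding N_def[symmetric] T_def[symmetric]
    proof (cases N)
      case top
      have "a powr (1 + enn2real (1 / p)) > 0" using a by simp
      then have "?rhs = \<infinity>" using top by (simp add: ennreal_mult_top)
      then show ?thesis by simp
    next
      case (real n)
      define E where "E = C * a powr (1 + enn2real (1 / p)) * n"
      have E: "E \<ge> 0" using C real by (simp add: E_def)
      have "\<bar>measure \<mu> (ball z R) - measure \<nu> (ball z R)\<bar> \<le> 2 * (E + T)" if R: "R > 0" for z R
      proof (rule ball_discrepancy_le[OF \<mu> \<nu> h(1) assms R _ annulus measure_ball_eq_1_of_support[OF \<nu> supp]])
        fix c :: complex and r s :: real
        assume rs: "0 \<le> r" "0 \<le> s" "s \<le> K"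
        interpret disc_pair_cutoff c r s h using rs h by unfold_locales
        have "ennreal \<bar>(\<integral>t. test t \<partial>\<mu>) - (\<integral>t. test t \<partial>\<nu>)\<bar> \<le> ennreal (C * (1 / h) powr (1 + enn2real (1 / p))) * N"
          using test_discrepancy[OF \<mu> \<nu> rs(3) h(2) p] real unfolding C_def N_def h_def by simp
        also have "\<dots> = ennreal E"
          using real C by (simp add: E_def h_def flip: ennreal_mult)
        finally show "\<bar>(\<integral>t. test t \<partial>\<mu>) - (\<integral>t. test t \<partial>\<nu>)\<bar> \<le> E"
          using E by (simp add: ennreal_le_iff)
      qed
      then have "kolmogorov_ball_dist \<mu> \<nu> \<le> 2 * (E + T)"
        unfolding kolmogorov_ball_dist_def by (intro cSUP_least) auto
      also have "\<dots> \<le> 2 * max C 1 * (a powr (1 + enn2real (1 / p)) * n + T)"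
      proof -
        have "C * (a powr (1 + enn2real (1 / p)) * n) \<le> max C 1 * (a powr (1 + enn2real (1 / p)) * n)"
          using real by (intro mult_right_mono) auto
        moreover have "1 * T \<le> max C 1 * T" using T by (intro mult_right_mono) auto
        ultimately show ?thesis by (simp add: E_def algebra_simps)
      qed
      finally have "ennreal (kolmogorov_ball_dist \<mu> \<nu>)
          \<le> ennreal (2 * max C 1 * (a powr (1 + enn2real (1 / p)) * n + T))" by (rule ennreal_leI)
      also have "\<dots> = ?rhs"
        using real T by (simp add: ennreal_mult ennreal_plus)
      finally show ?thesis .
    qed
  qed
qed

end
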